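(* Let $(S,\mathcal S)$ be a metric space with its Borel $\sigma$-field, let $X=(X_n,n\in\mathbb T)$ be a bifurcating Markov chain on $S$ with initial distribution $\nu$ and $\mathbb T$-transition probability $P$, and let $\Pi$ be a uniform generation-preserving random permutation independent of $X$. Let $F$ be an admissible space of functions with limit probability $\mu$. Then, for any $f\in F$, the three empirical averages $\overline M_{\mathbb G_q}(f)$ (as $q\to\infty$), $\overline M_{\mathbb T_r}(f)$ (as $r\to\infty$) and $\overline M_n^{\Pi}(f)$ (as $n\to\infty$) converge to $(\mu,f)=\int_S f\,d\mu$ in $L^2$.
   Context: Tree. $\mathbb T=\mathbb N^*=\{1,2,\dots\}$ is the binary tree: vertex $n$ has two daughters $2n$ and $2n+1$, the root is $1$. $\mathbb G_q=\{2^q,\dots,2^{q+1}-1\}$ is the $q$th generation, $\mathbb T_r=\bigcup_{q=0}^r\mathbb G_q$, $r_n=\lfloor\log_2 n\rfloor$ is the generation of $n$. $\mathbb T$-transition probability. A map $P:S\times\mathcal S^2\to[0,1]$ ($\mathcal S^2$ the product $\sigma$-field on $S^2$) such that $P(\cdot,A)$ is measurable for all $A\in\mathcal S^2$ and $P(x,\cdot)$ is a probability on $(S^2,\mathcal S^2)$ for all $x\in S$. Put $P_0(x,B)=P(x,B\times S)$, $P_1(x,B)=P(x,S\times B)$, $Q=(P_0+P_1)/2$; $Q^r$ is the $r$th iterate of $Q$ and $Q^rf(x)=\int_S f(y)Q^r(x,dy)$. For measurable $f:S^2\to\mathbb R$, $Pf(x)=\int_{S^2}f(y,z)P(x,dy\,dz)$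 when defined. Bifurcating Markov chain. On a filtered probability space $(\Omega,\mathcal F,(\mathcal F_r)_{r\in\mathbb N},\mathbb P)$, a family $(X_n,n\in\mathbb T)$ of $S$-valued random variables is a bifurcating Markov chain with initial distribution $\nu$ and $\mathbb T$-transition probability $P$ if $X_n$ is $\mathcal F_{r_n}$-measurable for all $n$, $X_1$ has law $\nu$, and for all $q\in\mathbb N$ and all families $(f_n,n\in\mathbb G_q)$ of bounded measurable functions on $S^2$, $\mathbb E[\prod_{n\in\mathbb G_q}f_n(X_{2n},X_{2n+1})\mid\mathcal F_q]=\prod_{n\in\mathbb G_q}Pf_n(X_n)$. The default filtration is $\mathcal F_r=\sigma(X_i,i\in\mathbb T_r)$. Admissible space. Let $\mathcal B(S)$ be the set of measurable functions $S\to\mathbb R$, and $(f\otimes g)(y,z)=f(y)g(z)$. A linear subspace $F\subset\mathcal B(S)$ is called admissible with limit probability $\mu$ (relative to $P,\nu$) if: (i) $F$ contains the constants; (ii) $f^2\in F$ for all $f\in F$; (iii) for all $f,g\in F$, $f\otimes g\in L^1(P(x,\cdot))$ for all $x\in S$, and $P(f\otimes g)\in F$; (iv) $\mu$ is a probability on $(S,\mathcal S)$ with $F\subset L^1(\mu)$ and $\lim_{r\to\infty}Q^rf(x)=\int_S f\,d\mu$ for all $x\in S$ and $f\in F$; (v) for all $f\in F$ there is $g\in F$ such that $|Q^rf|\le g$ for all $r\in\mathbb N$; (vi) $F\subset L^1(\nu)$. (Conditions (i) and (iii) imply that $Q^rf$ is well defined for $f\in F$.) Random permutation. $\Pi$ is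 a random permutation of $\mathbb N^*$ leaving each $\mathbb G_q$ invariant, whose restrictions to the $\mathbb G_q$ are independent over $q$, each uniform among the $(2^q)!$ permutations of $\mathbb G_q$. Averages. For measurable $f:S\to\mathbb R$ and finite $I\subset\mathbb T$: $\overline M_I(f)=|I|^{-1}\sum_{i\in I}f(X_i)$ and $\overline M_n^\Pi(f)=n^{-1}\sum_{i=1}^n f(X_{\Pi(i)})$. *)

theory Defs
  imports "HOL-Probability.Probability" "HOL-Combinatorics.Permutations"
begin

section \<open>The binary tree\<close>

text \<open>Vertices are the positive naturals; index \<open>0\<close> is never used.\<close>

definition generation :: "nat \<Rightarrow> nat set" where
  "generation q = {2 ^ q ..< 2 ^ (q + 1)}"

definition tree_upto :: "nat \<Rightarrow> nat set" where
  "tree_upto r = (\<Union>q\<le>r. generation q)"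

definition gen_of :: "nat \<Rightarrow> nat" where
  "gen_of n = nat \<lfloor>log 2 (real n)\<rfloor>"

section \<open>Transition probabilities\<close>

text \<open>The state space is a type of class \<open>metric_space\<close>. It need not be separable, so \<open>S\<^sup>2\<close>
  carries the product \<open>\<sigma>\<close>-field \<open>borel \<Otimes>\<^sub>M borel\<close>, which may be strictly smaller than the Borel
  \<open>\<sigma>\<close>-field of the product.\<close>

definition T_transition_probability :: "('s::metric_space \<Rightarrow> ('s \<times> 's) measure) \<Rightarrow> bool" where
  "T_transition_probability P \<longleftrightarrow>
     (\<forall>x. prob_space (P x) \<and> sets (P x) = sets (borel \<Otimes>\<^sub>M borel)) \<and>
     (\<forall>A \<in> sets (borel \<Otimes>\<^sub>M borel). (\<lambda>x. measure (P x) A) \<in> borel_measurable borel)"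

definition marginal0 :: "('s::metric_space \<Rightarrow> ('s \<times> 's) measure) \<Rightarrow> 's \<Rightarrow> 's measure" where
  "marginal0 P x = distr (P x) borel fst"

definition marginal1 :: "('s::metric_space \<Rightarrow> ('s \<times> 's) measure) \<Rightarrow> 's \<Rightarrow> 's measure" where
  "marginal1 P x = distr (P x) borel snd"

definition Q_kernel :: "('s::metric_space \<Rightarrow> ('s \<times> 's) measure) \<Rightarrow> 's \<Rightarrow> 's measure" where
  "Q_kernel P x = measure_of UNIV (sets borel) (\<lambda>B. (emeasure (marginal0 P x) B + emeasure (marginal1 P x) B) / 2)"

primrec Q_kernel_pow :: "('s::metric_space \<Rightarrow> ('s \<times> 's) measure) \<Rightarrow> nat \<Rightarrow> 's \<Rightarrow> 's measure" where
  "Q_kernel_pow P 0 x = return borel x"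
| "Q_kernel_pow P (Suc r) x = Q_kernel_pow P r x \<bind> Q_kernel P"

lemma T_transition_probability_measurable:
  "T_transition_probability P \<longleftrightarrow> P \<in> borel \<rightarrow>\<^sub>M prob_algebra (borel \<Otimes>\<^sub>M borel)"
proof
  assume P: "T_transition_probability P"
  show "P \<in> borel \<rightarrow>\<^sub>M prob_algebra (borel \<Otimes>\<^sub>M borel)"
  proof (rule measurable_prob_algebraI)
    fix x show "prob_space (P x)" using P by (simp add: T_transition_probability_def)
  next
    show "P \<in> borel \<rightarrow>\<^sub>M subprob_algebra (borel \<Otimes>\<^sub>M borel)"
    proof (rule measurable_subprob_algebra)
      fix x show "subprob_space (P x)"
        using P by (simp add: T_transition_probability_def prob_space_imp_subprob_space)
      show "sets (P x) = sets (borel \<Otimes>\<^sub>M borel)"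
        using P by (simp add: T_transition_probability_def)
    next
      fix A :: "('a \<times> 'a) set" assume "A \<in> sets (borel \<Otimes>\<^sub>M borel)"
      then have "(\<lambda>x. ennreal (measure (P x) A)) \<in> borel_measurable borel"
        using P by (auto simp: T_transition_probability_def)
      moreover have "emeasure (P x) A = ennreal (measure (P x) A)" for x
      proof -
        interpret prob_space "P x" using P by (simp add: T_transition_probability_def)
        show ?thesis by (rule emeasure_eq_measure)
      qed
      ultimately show "(\<lambda>x. emeasure (P x) A) \<in> borel_measurable borel" by simp
    qed
  qed
next
  assume P: "P \<in> borel \<rightarrow>\<^sub>M prob_algebra (borel \<Otimes>\<^sub>M borel)"
  then have "P \<in> borel \<rightarrow>\<^sub>M subprob_algebra (borel \<Otimes>\<^sub>M borel)"
    by (rule measurable_prob_algebraD)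
  then have "(\<lambda>x. measure (P x) A) \<in> borel_measurable borel" if "A \<in> sets (borel \<Otimes>\<^sub>M borel)" for A
    using measurable_compose[OF _ measurable_measure_subprob_algebra[OF that]] by blast
  moreover have "prob_space (P x) \<and> sets (P x) = sets (borel \<Otimes>\<^sub>M borel)" for x
    using measurable_space[OF P, of x] by (simp add: space_prob_algebra)
  ultimately show "T_transition_probability P" by (auto simp: T_transition_probability_def)
qed

lemma sets_Q_kernel [simp]: "sets (Q_kernel P x) = sets borel"
  by (simp add: Q_kernel_def sets.sigma_sets_eq[of borel, simplified])

lemma emeasure_Q_kernel:
  assumes "B \<in> sets borel"
  shows "emeasure (Q_kernel P x) B = (emeasure (marginal0 P x) B + emeasure (marginal1 P x) B) / 2"
proof (rule emeasure_measure_of[OF Q_kernel_def])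
  show "countably_additive (sets (Q_kernel P x)) (\<lambda>B. (emeasure (marginal0 P x) B + emeasure (marginal1 P x) B) / 2)"
  proof (rule countably_additiveI)
    fix A :: "nat \<Rightarrow> 'a set"
    assume A: "range A \<subseteq> sets (Q_kernel P x)" "disjoint_family A"
    have "(\<Sum>i. emeasure (marginal0 P x) (A i)) = emeasure (marginal0 P x) (\<Union>i. A i)"
      by (rule suminf_emeasure) (use A in \<open>auto simp: marginal0_def\<close>)
    moreover have "(\<Sum>i. emeasure (marginal1 P x) (A i)) = emeasure (marginal1 P x) (\<Union>i. A i)"
      by (rule suminf_emeasure) (use A in \<open>auto simp: marginal1_def\<close>)
    ultimately show "(\<Sum>i. (emeasure (marginal0 P x) (A i) + emeasure (marginal1 P x) (A i)) / 2) =
        (emeasure (marginal0 P x) (\<Union>i. A i) + emeasure (marginal1 P x) (\<Union>i. A i)) / 2"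
      by (simp add: divide_ennreal_def suminf_add[OF summableI summableI, symmetric])
  qed
qed (use assms in \<open>auto simp: positive_def\<close>)

section \<open>Bifurcating Markov chains\<close>

locale bifurcating_markov_chain =
  prob_space M + filtration "space M" Fil
  for M :: "'w measure" and Fil :: "nat \<Rightarrow> 'w measure" +
  fixes X :: "nat \<Rightarrow> 'w \<Rightarrow> 's::metric_space"
    and \<nu> :: "'s measure"
    and P :: "'s \<Rightarrow> ('s \<times> 's) measure"
  assumes subalgebra_Fil: "\<And>r. subalgebra M (Fil r)"
    and transition: "T_transition_probability P"
    and adapted: "\<And>n. n \<ge> 1 \<Longrightarrow> X n \<in> Fil (gen_of n) \<rightarrow>\<^sub>M borel"
    and initial: "distr M borel (X 1) = \<nu>"
    and branching: "\<And>q f.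
      (\<And>n. n \<in> generation q \<Longrightarrow> f n \<in> borel_measurable (borel \<Otimes>\<^sub>M borel) \<and> bounded (range (f n)))
      \<Longrightarrow> AE \<omega> in M.
            real_cond_exp M (Fil q) (\<lambda>\<omega>. \<Prod>n\<in>generation q. f n (X (2 * n) \<omega>, X (2 * n + 1) \<omega>)) \<omega>
            = (\<Prod>n\<in>generation q. \<integral>yz. f n yz \<partial>P (X n \<omega>))"

section \<open>Admissible function spaces\<close>

definition tensor :: "('s \<Rightarrow> real) \<Rightarrow> ('s \<Rightarrow> real) \<Rightarrow> 's \<times> 's \<Rightarrow> real" where
  "tensor f g = (\<lambda>(y, z). f y * g z)"

definition admissible ::
  "('s::metric_space \<Rightarrow> ('s \<times> 's) measure) \<Rightarrow> 's measure \<Rightarrow> 's measure \<Rightarrow> ('s \<Rightarrow> real) set \<Rightarrow> bool" where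
  "admissible P \<nu> \<mu> F \<longleftrightarrow>
     F \<subseteq> borel_measurable borel \<and>
     (\<forall>f\<in>F. \<forall>g\<in>F. (\<lambda>x. f x + g x) \<in> F) \<and>
     (\<forall>f\<in>F. \<forall>c. (\<lambda>x. c * f x) \<in> F) \<and>
     (\<forall>c. (\<lambda>x. c) \<in> F) \<and>
     (\<forall>f\<in>F. (\<lambda>x. (f x)\<^sup>2) \<in> F) \<and>
     (\<forall>f\<in>F. \<forall>g\<in>F. (\<forall>x. integrable (P x) (tensor f g)) \<and>
        (\<lambda>x. \<integral>yz. tensor f g yz \<partial>P x) \<in> F) \<and>
     (prob_space \<mu> \<and> sets \<mu> = sets borel \<and>
        (\<forall>f\<in>F. integrable \<mu> f) \<and>
        (\<forall>f\<in>F. \<forall>x. (\<lambda>r. \<integral>y. f y \<partial>Q_kernel_pow P r x) \<longlonglongrightarrow> (\<integral>y. f y \<partial>\<mu>))) \<and>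
     (\<forall>f\<in>F. \<exists>g\<in>F. \<forall>r x. \<bar>\<integral>y. f y \<partial>Q_kernel_pow P r x\<bar> \<le> g x) \<and>
     (\<forall>f\<in>F. integrable \<nu> f)"

section \<open>The random permutation\<close>

text \<open>The restriction of the permutation to a generation is represented by its extension by the
  identity, so that it takes values in the finite set of maps with \<open>_ permutes generation q\<close>.\<close>

definition uniform_generation_permutation :: "'w measure \<Rightarrow> ('w \<Rightarrow> nat \<Rightarrow> nat) \<Rightarrow> bool" where
  "uniform_generation_permutation M Perm \<longleftrightarrow>
     (\<forall>\<omega>\<in>space M. bij_betw (Perm \<omega>) {1..} {1..} \<and> (\<forall>q. Perm \<omega> ` generation q = generation q)) \<and>
     prob_space.indep_vars M (\<lambda>q. count_space {\<sigma>. \<sigma> permutes generation q})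
       (\<lambda>q \<omega>. restrict_id (Perm \<omega>) (generation q)) UNIV \<and>
     (\<forall>q. distr M (count_space {\<sigma>. \<sigma> permutes generation q}) (\<lambda>\<omega>. restrict_id (Perm \<omega>) (generation q))
        = uniform_count_measure {\<sigma>. \<sigma> permutes generation q})"

text \<open>Independence is stated for the generated \<open>\<sigma>\<close>-fields because \<open>indep_var\<close> requires both
  random elements to have the same type.\<close>

definition perm_indep_process ::
  "'w measure \<Rightarrow> ('w \<Rightarrow> nat \<Rightarrow> nat) \<Rightarrow> (nat \<Rightarrow> 'w \<Rightarrow> 's::metric_space) \<Rightarrow> bool" where
  "perm_indep_process M Perm X \<longleftrightarrow>
     prob_space.indep_set M
       (sets (vimage_algebra (space M) (\<lambda>\<omega>. \<lambda>n\<in>{1..}. Perm \<omega> n) (\<Pi>\<^sub>M n\<in>{1..}. count_space UNIV)))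
       (sets (vimage_algebra (space M) (\<lambda>\<omega>. \<lambda>n\<in>{1..}. X n \<omega>) (\<Pi>\<^sub>M n\<in>{1..}. borel)))"

section \<open>Empirical averages and convergence in mean square\<close>

definition avg :: "(nat \<Rightarrow> 'w \<Rightarrow> 's) \<Rightarrow> nat set \<Rightarrow> ('s \<Rightarrow> real) \<Rightarrow> 'w \<Rightarrow> real" where
  "avg X I f \<omega> = (\<Sum>i\<in>I. f (X i \<omega>)) / real (card I)"

definition perm_avg ::
  "(nat \<Rightarrow> 'w \<Rightarrow> 's) \<Rightarrow> ('w \<Rightarrow> nat \<Rightarrow> nat) \<Rightarrow> nat \<Rightarrow> ('s \<Rightarrow> real) \<Rightarrow> 'w \<Rightarrow> real" where
  "perm_avg X Perm n f \<omega> = (\<Sum>i=1..n. f (X (Perm \<omega> i) \<omega>)) / real n"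

definition square_integrable :: "'w measure \<Rightarrow> ('w \<Rightarrow> real) \<Rightarrow> bool" where
  "square_integrable M Y \<longleftrightarrow> Y \<in> borel_measurable M \<and> integrable M (\<lambda>\<omega>. (Y \<omega>)\<^sup>2)"

definition tendsto_L2 :: "'w measure \<Rightarrow> (nat \<Rightarrow> 'w \<Rightarrow> real) \<Rightarrow> ('w \<Rightarrow> real) \<Rightarrow> bool" where
  "tendsto_L2 M Y Z \<longleftrightarrow>
     (\<forall>n. square_integrable M (Y n)) \<and> square_integrable M Z \<and>
     (\<lambda>n. \<integral>\<omega>. (Y n \<omega> - Z \<omega>)\<^sup>2 \<partial>M) \<longlonglongrightarrow> 0"

end

theory Submission
  imports Defs
begin

text \<open>
  Write \<open>T q f\<close> for the sum of \<open>f (X n)\<close> over generation \<open>q\<close> and \<open>K\<close> for the operator induced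
  by \<open>Q\<close> on \<open>F\<close>. Conditionally on \<open>Fil q\<close> the pairs of daughters are independent, and
  the expected sum of \<open>f\<close> over the daughters of \<open>n\<close> is \<open>2 K f (X n)\<close>; hence the second moment of
  \<open>T (q + 1) f\<close> is at most four times that of \<open>T q (K f)\<close> plus a diagonal term of order
  \<open>2 ^ q\<close>. Normalising by \<open>4 ^ q\<close> and iterating bounds the second moment of the generation average
  by \<open>\<nu> ((K ^^ q) f)\<^sup>2\<close> plus the sum over \<open>p < q\<close> of
  \<open>2 ^ (-p) \<nu> (K ^^ (p + 1)) ((K ^^ (q - 1 - p)) f)\<^sup>2\<close>. If \<open>\<mu> f = 0\<close>, every term tends to \<open>0\<close>
  by dominated convergence, and Tannery's theorem gives the convergence of the sum. The tree
  average is a geometrically weighted mean of the generation averages. The permuted average splits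
  into complete generations and a uniform sample without replacement from the last one, whose second
  moment is controlled by those of the whole generation.
\<close>

section \<open>Geometric convolutions and the binary tree\<close>

lemma four_power: "(4::real) ^ q = (2 ^ q)\<^sup>2"
  by (simp add: power2_eq_square flip: power_mult_distrib)

text \<open>Tannery's theorem with the summable majorant \<open>C * (1/2) ^ p\<close>: for each
  fixed \<open>p\<close> the index \<open>q - 1 - p\<close> tends to infinity, so every term
  vanishes in the limit. It serves both the bound for a single generation and the weighted mean over
  generations.\<close>

lemma tendsto_geometric_convolution_zero:
  fixes a :: "nat \<Rightarrow> nat \<Rightarrow> real"
  assumes bound: "\<And>p r. \<bar>a p r\<bar> \<le> C" and lim: "\<And>p. a p \<longlonglongrightarrow> 0"
  shows "(\<lambda>q. \<Sum>p<q. (1/2) ^ p * a p (q - 1 - p)) \<longlonglongrightarrow> 0"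
proof -
  \<comment> \<open>Padding by zero replaces the sums of growing length by series over all
    \<open>p\<close>, the form in which limit and sum can be exchanged.\<close>
  define b where "b p q = (if p < q then (1/2) ^ p * a p (q - 1 - p) else 0)" for p q
  have "(\<lambda>q. \<Sum>p. b p q) \<longlonglongrightarrow> (\<Sum>p. 0)"
  proof (rule tannerys_theorem[where M = "\<lambda>p. C * (1/2) ^ p", THEN conjunct2, THEN conjunct2])
    fix p
    have "(\<lambda>q. (1/2) ^ p * a p (q - (1 + p))) \<longlonglongrightarrow> (1/2) ^ p * 0"
      by (intro tendsto_mult tendsto_const filterlim_compose[OF lim filterlim_minus_const_nat_at_top])
    moreover have "\<forall>\<^sub>F q in sequentially. (1/2) ^ p * a p (q - (1 + p)) = b p q"
      using eventually_gt_at_top[of p] by eventually_elim (simp add: b_def)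
    ultimately have "b p \<longlonglongrightarrow> (1/2) ^ p * 0" by (rule Lim_transform_eventually)
    then show "b p \<longlonglongrightarrow> 0" by simp
  next
    have "norm (b p q) \<le> C * (1/2) ^ p" for p q
      using bound[of p "q - 1 - p"] bound[of 0 0]
      by (auto simp: b_def abs_mult mult.commute intro!: mult_right_mono)
    then show "eventually (\<lambda>(p, q). norm (b p q) \<le> C * (1/2) ^ p) (at_top \<times>\<^sub>F sequentially)"
      by (intro always_eventually) auto
  qed (auto intro!: summable_mult summable_geometric)
  moreover have "(\<Sum>p. b p q) = (\<Sum>p<q. (1/2) ^ p * a p (q - 1 - p))" for q
    by (subst suminf_finite[of "{..<q}"]) (auto simp: b_def)
  ultimately show ?thesis by (simp only: suminf_zero)
qed

text \<open>Cauchy-Schwarz for the vectors \<open>sqrt (w i)\<close> and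
  \<open>sqrt (w i) * y i\<close>.\<close>

lemma square_sum_weighted_le:
  fixes w y :: "'a \<Rightarrow> real"
  assumes "\<And>i. i \<in> I \<Longrightarrow> 0 \<le> w i"
  shows "(\<Sum>i\<in>I. w i * y i)\<^sup>2 \<le> (\<Sum>i\<in>I. w i) * (\<Sum>i\<in>I. w i * (y i)\<^sup>2)"
proof -
  have "(\<Sum>i\<in>I. sqrt (w i) * (sqrt (w i) * y i))\<^sup>2 \<le> (\<Sum>i\<in>I. (sqrt (w i))\<^sup>2) * (\<Sum>i\<in>I. (sqrt (w i) * y i)\<^sup>2)"
    by (rule Cauchy_Schwarz_ineq_sum)
  moreover have "(\<Sum>i\<in>I. sqrt (w i) * (sqrt (w i) * y i)) = (\<Sum>i\<in>I. w i * y i)"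
    using assms by (intro sum.cong) (auto simp: mult.assoc[symmetric])
  ultimately show ?thesis using assms by (simp add: power_mult_distrib)
qed

section \<open>Generations of the binary tree\<close>

lemma finite_generation [simp]: "finite (generation q)"
  and card_generation [simp]: "card (generation q) = 2 ^ q"
  by (auto simp: generation_def)

text \<open>The generations are the fibres of \<open>gen_of\<close> over the positive naturals.
  Their disjointness and the side conditions \<open>n \<ge> 1\<close> are later read off from this
  form.\<close>

lemma mem_generation_iff: "n \<in> generation q \<longleftrightarrow> n \<ge> 1 \<and> gen_of n = q"
proof -
  have *: "gen_of n = q" if "n \<in> generation q" for n q
    using that floor_log_nat_eq_if[of 2 q n] by (auto simp: generation_def gen_of_def)
  have "n \<in> generation (gen_of n)" if n: "n \<ge> 1"
  proof -
    obtain q where "n \<in> generation q"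
      using ex_power_ivl1[of 2 n] n by (auto simp: generation_def)
    with *[OF this] show ?thesis by simp
  qed
  moreover have "n \<ge> 1" if "n \<in> generation q"
    using that one_le_power[of "2::nat" q] by (auto simp: generation_def simp del: one_le_power)
  ultimately show ?thesis using * by blast
qed

lemma sum_generation_Suc:
  fixes h :: "nat \<Rightarrow> 'a::comm_monoid_add"
  shows "(\<Sum>n\<in>generation (Suc q). h n) = (\<Sum>n\<in>generation q. h (2 * n) + h (2 * n + 1))"
proof -
  have "generation (Suc q) = (\<lambda>n. 2 * n) ` generation q \<union> (\<lambda>n. 2 * n + 1) ` generation q"
  proof (intro equalityI subsetI)
    fix n assume "n \<in> generation (Suc q)"
    then have "n div 2 \<in> generation q" by (auto simp: generation_def)
    moreover have "n = 2 * (n div 2) \<or> n = 2 * (n div 2) + 1" by presburger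
    ultimately show "n \<in> (\<lambda>n. 2 * n) ` generation q \<union> (\<lambda>n. 2 * n + 1) ` generation q" by blast
  qed (auto simp: generation_def)
  moreover have "(\<lambda>n. 2 * n) ` generation q \<inter> (\<lambda>n. 2 * n + 1) ` generation q = {}" by auto presburger
  ultimately show ?thesis
    by (simp add: sum.union_disjoint sum.reindex inj_on_def sum.distrib)
qed

lemma generation_0: "generation 0 = {1}"
  by (auto simp: generation_def)

lemma UN_generation: "(\<Union>q<r. generation q) = {1..<2 ^ r}"
proof (induction r)
  case (Suc r)
  have "1 \<le> (2::nat) ^ r" by simp
  with Suc show ?case by (auto simp: lessThan_Suc generation_def simp del: one_le_power)
qed simp

lemma tree_upto_eq: "tree_upto r = {1..<2 ^ Suc r}"
  unfolding tree_upto_def UN_generation[symmetric] by (simp add: lessThan_Suc_atMost)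

lemma sum_UN_generation:
  fixes h :: "nat \<Rightarrow> 'a::comm_monoid_add"
  shows "(\<Sum>i\<in>{1..<2 ^ r}. h i) = (\<Sum>q<r. \<Sum>i\<in>generation q. h i)"
  unfolding UN_generation[symmetric]
  by (rule sum.UNION_disjoint) (auto simp: mem_generation_iff)

lemma filterlim_gen_of: "filterlim gen_of at_top sequentially"
proof (subst filterlim_at_top, intro allI)
  fix q
  show "\<forall>\<^sub>F n in sequentially. q \<le> gen_of n"
    using eventually_ge_at_top[of "2 ^ q"]
  proof eventually_elim
    case (elim n)
    then have "n > 0" using less_le_trans[of 0 "2 ^ q" n] by simp
    then have "n \<in> generation (gen_of n)" by (simp add: mem_generation_iff)
    then have "(2::nat) ^ q < 2 ^ (gen_of n + 1)" using elim by (simp add: generation_def)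
    then show ?case by (simp add: power_strict_increasing_iff del: power_Suc)
  qed
qed

section \<open>Sampling without replacement\<close>

text \<open>By symmetry the sum over permutations is the same for every ordered pair of distinct
  indices. Adding it up over all such pairs leaves, for each permutation, the square of the total
  minus the diagonal.\<close>

lemma sum_permutes_pair:
  fixes a :: "'a \<Rightarrow> real"
  assumes "finite G" "i \<in> G" "j \<in> G" "i \<noteq> j"
  shows "real (card G * (card G - 1)) * (\<Sum>\<sigma> | \<sigma> permutes G. a (\<sigma> i) * a (\<sigma> j)) =
    fact (card G) * ((\<Sum>x\<in>G. a x)\<^sup>2 - (\<Sum>x\<in>G. (a x)\<^sup>2))"
proof -
  define S where "S i j = (\<Sum>\<sigma> | \<sigma> permutes G. a (\<sigma> i) * a (\<sigma> j))" for i j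
  have S: "S i' j' = S i j" if "i' \<in> G" "j' \<in> G" "i' \<noteq> j'" for i' j'
  proof -
    \<comment> \<open>First \<open>i\<close> is moved to \<open>i'\<close>, then the current image
      of \<open>j\<close> to \<open>j'\<close>. The second transposition fixes \<open>i'\<close>,
      because neither \<open>p j\<close> nor \<open>j'\<close> equals \<open>i'\<close>.\<close>
    define p where "p = Transposition.transpose i i'"
    define \<tau> where "\<tau> = Transposition.transpose (p j) j' \<circ> p"
    have "p permutes G" "p j \<in> G"
      using assms that by (auto simp: p_def permutes_swap_id Transposition.transpose_def)
    then have \<tau>: "\<tau> permutes G"
      using that unfolding \<tau>_def by (intro permutes_compose permutes_swap_id)
    have "p j \<noteq> i'" using assms by (auto simp: p_def Transposition.transpose_def)
    then have "\<tau> i = i'" "\<tau> j = j'"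
      using that by (auto simp: \<tau>_def p_def)
    then show ?thesis
      unfolding S_def by (subst sum_permutations_compose_right[OF \<tau>]) (simp add: o_def)
  qed
  have *: "(\<Sum>i'\<in>G. \<Sum>j'\<in>G - {i'}. a (\<sigma> i') * a (\<sigma> j')) = (\<Sum>x\<in>G. a x)\<^sup>2 - (\<Sum>x\<in>G. (a x)\<^sup>2)"
    if "\<sigma> permutes G" for \<sigma>
  proof -
    have "(\<Sum>i'\<in>G. \<Sum>j'\<in>G - {i'}. a (\<sigma> i') * a (\<sigma> j')) =
        (\<Sum>i'\<in>G. a (\<sigma> i') * (\<Sum>j'\<in>G. a (\<sigma> j')) - (a (\<sigma> i'))\<^sup>2)"
      using assms by (intro sum.cong) (auto simp: sum_distrib_left[symmetric] sum_diff1 power2_eq_square algebra_simps)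
    also have "\<dots> = (\<Sum>x\<in>G. a x)\<^sup>2 - (\<Sum>x\<in>G. (a x)\<^sup>2)"
      using sum.permute[OF that, of a] sum.permute[OF that, of "\<lambda>x. (a x)\<^sup>2"]
      by (simp add: sum_subtractf sum_distrib_right[symmetric] power2_eq_square o_def)
    finally show ?thesis .
  qed
  have "real (card G * (card G - 1)) * S i j = (\<Sum>i'\<in>G. \<Sum>j'\<in>G - {i'}. S i' j')"
  proof -
    have "(\<Sum>i'\<in>G. \<Sum>j'\<in>G - {i'}. S i' j') = (\<Sum>i'\<in>G. \<Sum>j'\<in>G - {i'}. S i j)"
      by (intro sum.cong refl S) auto
    then show ?thesis using assms by (simp add: card_Diff_singleton)
  qed
  also have "\<dots> = (\<Sum>\<sigma> | \<sigma> permutes G. \<Sum>i'\<in>G. \<Sum>j'\<in>G - {i'}. a (\<sigma> i') * a (\<sigma> j'))"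
    unfolding S_def by (simp add: sum.swap[of _ "{\<sigma>. \<sigma> permutes G}"])
  also have "\<dots> = (\<Sum>\<sigma> | \<sigma> permutes G. (\<Sum>x\<in>G. a x)\<^sup>2 - (\<Sum>x\<in>G. (a x)\<^sup>2))"
    using * by (intro sum.cong) auto
  also have "\<dots> = fact (card G) * ((\<Sum>x\<in>G. a x)\<^sup>2 - (\<Sum>x\<in>G. (a x)\<^sup>2))"
    by (simp add: card_permutations[OF refl \<open>finite G\<close>])
  finally show ?thesis by (simp add: S_def)
qed

lemma sum_permutes_single:
  fixes a :: "'a \<Rightarrow> real"
  assumes "finite G" "i \<in> G"
  shows "real (card G) * (\<Sum>\<sigma> | \<sigma> permutes G. a (\<sigma> i)) = fact (card G) * (\<Sum>x\<in>G. a x)"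
proof -
  define S where "S i = (\<Sum>\<sigma> | \<sigma> permutes G. a (\<sigma> i))" for i
  have S: "S i' = S i" if "i' \<in> G" for i'
    unfolding S_def using assms that
    by (subst sum_permutations_compose_right[OF permutes_swap_id[of i G i']]) (auto simp: o_def)
  have "real (card G) * S i = (\<Sum>i'\<in>G. S i')" by (simp add: S cong: sum.cong)
  also have "\<dots> = (\<Sum>\<sigma> | \<sigma> permutes G. \<Sum>i'\<in>G. a (\<sigma> i'))"
    unfolding S_def by (rule sum.swap)
  also have "\<dots> = (\<Sum>\<sigma> | \<sigma> permutes G. \<Sum>x\<in>G. a x)"
    using sum.permute[of _ G a] by (intro sum.cong[OF refl, of "{\<sigma>. \<sigma> permutes G}"]) (simp add: o_def)
  also have "\<dots> = fact (card G) * (\<Sum>x\<in>G. a x)"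
    by (simp add: card_permutations[OF refl \<open>finite G\<close>])
  finally show ?thesis by (simp add: S_def)
qed

text \<open>This is the second moment of a sample of size \<open>card I\<close> drawn without
  replacement. Diagonal terms average to the mean of the squares; off-diagonal terms contribute at
  most as much as under sampling with replacement, since
  \<open>(k - 1) / (N - 1) \<le> k / N\<close>.\<close>

lemma sum_permutes_square_le:
  fixes a :: "'a \<Rightarrow> real"
  assumes G: "finite G" and I: "I \<subseteq> G"
  defines "t \<equiv> real (card I) / real (card G)"
  shows "(\<Sum>\<sigma> | \<sigma> permutes G. (\<Sum>i\<in>I. a (\<sigma> i))\<^sup>2) / fact (card G)
    \<le> t * (\<Sum>x\<in>G. (a x)\<^sup>2) + t\<^sup>2 * (\<Sum>x\<in>G. a x)\<^sup>2"
proof -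
  define A where "A = (\<Sum>x\<in>G. (a x)\<^sup>2)"
  define B where "B = (\<Sum>x\<in>G. a x)\<^sup>2"
  define N where "N = card G"
  define k where "k = card I"
  have kN: "k \<le> N" using G I by (simp add: N_def k_def card_mono)
  have finI: "finite I" using G I finite_subset by blast
  have diag: "(\<Sum>\<sigma> | \<sigma> permutes G. a (\<sigma> i) * a (\<sigma> i)) = fact N * (A / N)" if "i \<in> I" for i
  proof -
    have "N > 0" using that I G by (auto simp: N_def card_gt_0_iff)
    then show ?thesis
      using sum_permutes_single[OF G, of i "\<lambda>x. a x * a x"] that I
      by (auto simp: A_def N_def power2_eq_square field_simps)
  qed
  have off: "(\<Sum>\<sigma> | \<sigma> permutes G. a (\<sigma> i) * a (\<sigma> j)) \<le> fact N * (B / (real N * real (N - 1)))"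
    if "i \<in> I" "j \<in> I - {i}" for i j
  proof -
    \<comment> \<open>Two distinct indices force \<open>N \<ge> 2\<close>, which makes the division
      by \<open>N - 1\<close> legitimate.\<close>
    have "card {i, j} \<le> N" unfolding N_def using that I G by (intro card_mono) auto
    then have N: "N \<ge> 2" using that by (auto simp: card_insert_if)
    have "real N * real (N - 1) * (\<Sum>\<sigma> | \<sigma> permutes G. a (\<sigma> i) * a (\<sigma> j)) = fact N * (B - A)"
      using sum_permutes_pair[OF G, of i j a] that I by (auto simp: A_def B_def N_def)
    also have "\<dots> \<le> fact N * B"
      by (intro mult_left_mono) (auto simp: A_def intro!: sum_nonneg)
    finally show ?thesis using N by (simp add: field_simps)
  qed
  have "(\<Sum>\<sigma> | \<sigma> permutes G. (\<Sum>i\<in>I. a (\<sigma> i))\<^sup>2)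
      = (\<Sum>i\<in>I. \<Sum>j\<in>I. \<Sum>\<sigma> | \<sigma> permutes G. a (\<sigma> i) * a (\<sigma> j))"
    by (simp add: power2_eq_square sum_product sum.swap[of _ "{\<sigma>. \<sigma> permutes G}"])
  also have "\<dots> = (\<Sum>i\<in>I. (\<Sum>\<sigma> | \<sigma> permutes G. a (\<sigma> i) * a (\<sigma> i))
      + (\<Sum>j\<in>I - {i}. \<Sum>\<sigma> | \<sigma> permutes G. a (\<sigma> i) * a (\<sigma> j)))"
    using finI by (intro sum.cong) (auto simp: sum.remove)
  also have "\<dots> \<le> (\<Sum>i\<in>I. fact N * (A / N) + (\<Sum>j\<in>I - {i}. fact N * (B / (real N * real (N - 1)))))"
    using off by (intro sum_mono add_mono) (auto simp: diag)
  also have "\<dots> = fact N * (k / N * A + (k / N) * (real (k - 1) / real (N - 1)) * B)"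
    using finI by (simp add: k_def card_Diff_singleton algebra_simps)
  also have "\<dots> \<le> fact N * (k / N * A + (k / N) * (k / N) * B)"
  proof (intro mult_left_mono add_left_mono mult_right_mono)
    \<comment> \<open>For \<open>k \<le> 1\<close> truncated subtraction makes the left side 0;
      otherwise the inequality amounts to \<open>k \<le> N\<close>.\<close>
    show "real (k - 1) / real (N - 1) \<le> k / N"
    proof (cases "k \<le> 1")
      case False
      then show ?thesis using kN by (simp add: field_simps of_nat_diff)
    qed simp
  qed (auto simp: B_def)
  finally have "(\<Sum>\<sigma> | \<sigma> permutes G. (\<Sum>i\<in>I. a (\<sigma> i))\<^sup>2) \<le> (k / N * A + (k / N)\<^sup>2 * B) * fact N"
    by (simp only: power2_eq_square mult.commute)
  then have "(\<Sum>\<sigma> | \<sigma> permutes G. (\<Sum>i\<in>I. a (\<sigma> i))\<^sup>2) / fact N \<le> k / N * A + (k / N)\<^sup>2 * B"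
    by (subst pos_divide_le_eq) auto
  then show ?thesis by (simp only: A_def B_def t_def N_def k_def)
qed

section \<open>Square integrable functions and independence\<close>

lemma abs_integral_le_integral:
  fixes f g :: "'a \<Rightarrow> real"
  assumes "integrable M f" "integrable M g" "\<And>x. \<bar>f x\<bar> \<le> g x"
  shows "\<bar>\<integral>x. f x \<partial>M\<bar> \<le> (\<integral>x. g x \<partial>M)"
  using assms by (intro order_trans[OF integral_abs_bound] integral_mono) auto

lemma square_integrable_mult:
  assumes "square_integrable M f" "square_integrable M g"
  shows "integrable M (\<lambda>\<omega>. f \<omega> * g \<omega>)"
proof (rule Bochner_Integration.integrable_bound)
  show "integrable M (\<lambda>\<omega>. (f \<omega>)\<^sup>2 + (g \<omega>)\<^sup>2)"
    using assms by (simp add: square_integrable_def)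
  show "(\<lambda>\<omega>. f \<omega> * g \<omega>) \<in> borel_measurable M"
    using assms by (auto simp: square_integrable_def)
  have "\<bar>a * b\<bar> \<le> a\<^sup>2 + b\<^sup>2" for a b :: real
  proof -
    have "0 \<le> (\<bar>a\<bar> - \<bar>b\<bar>)\<^sup>2" by simp
    then have "2 * (\<bar>a\<bar> * \<bar>b\<bar>) \<le> a\<^sup>2 + b\<^sup>2" by (simp add: power2_diff mult.assoc)
    moreover have "0 \<le> \<bar>a\<bar> * \<bar>b\<bar>" by simp
    ultimately show ?thesis unfolding abs_mult by linarith
  qed
  then show "AE \<omega> in M. norm (f \<omega> * g \<omega>) \<le> norm ((f \<omega>)\<^sup>2 + (g \<omega>)\<^sup>2)"
    by (intro always_eventually) (simp add: abs_of_nonneg)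
qed

lemma square_integrable_add:
  assumes "square_integrable M f" "square_integrable M g"
  shows "square_integrable M (\<lambda>\<omega>. f \<omega> + g \<omega>)"
  using assms square_integrable_mult[OF assms]
  by (auto simp: square_integrable_def power2_sum mult.assoc)

lemma square_integrable_cmult:
  "square_integrable M f \<Longrightarrow> square_integrable M (\<lambda>\<omega>. c * f \<omega>)"
  by (auto simp: square_integrable_def power_mult_distrib)

lemma square_integrable_sum:
  "(\<And>i. i \<in> I \<Longrightarrow> square_integrable M (f i)) \<Longrightarrow> square_integrable M (\<lambda>\<omega>. \<Sum>i\<in>I. f i \<omega>)"
proof (induction I rule: infinite_finite_induct)
  case (insert i I)
  then show ?case by (simp add: square_integrable_add)
qed (auto simp: square_integrable_def)

lemma integral_square_sum:
  assumes "finite I" "\<And>i. i \<in> I \<Longrightarrow> square_integrable M (Y i)"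
  shows "(\<integral>\<omega>. (\<Sum>i\<in>I. Y i \<omega>)\<^sup>2 \<partial>M) =
    (\<Sum>i\<in>I. (\<integral>\<omega>. (Y i \<omega>)\<^sup>2 \<partial>M) + (\<Sum>j\<in>I - {i}. \<integral>\<omega>. Y i \<omega> * Y j \<omega> \<partial>M))"
proof -
  have "(\<integral>\<omega>. (\<Sum>i\<in>I. Y i \<omega>)\<^sup>2 \<partial>M) = (\<Sum>i\<in>I. \<Sum>j\<in>I. \<integral>\<omega>. Y i \<omega> * Y j \<omega> \<partial>M)"
    unfolding power2_eq_square sum_product
    by (simp add: assms square_integrable_mult integrable_sum)
  also have "\<dots> = (\<Sum>i\<in>I. (\<integral>\<omega>. (Y i \<omega>)\<^sup>2 \<partial>M) + (\<Sum>j\<in>I - {i}. \<integral>\<omega>. Y i \<omega> * Y j \<omega> \<partial>M))"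
    by (intro sum.cong refl, subst sum.remove[OF assms(1)]) (auto simp: power2_eq_square)
  finally show ?thesis .
qed

text \<open>Independence of permutation and chain is given for \<open>\<sigma>\<close>-fields,
  whereas the product formula for integrals needs independent variables. The fields generated by
  \<open>f\<close> and \<open>g\<close> lie inside those of \<open>A\<close> and
  \<open>B\<close>.\<close>

lemma (in prob_space) indep_var_of_indep_set:
  assumes indep: "indep_set (sets A) (sets B)" and sp: "space A = space M" "space B = space M"
    and f: "f \<in> A \<rightarrow>\<^sub>M S" and g: "g \<in> B \<rightarrow>\<^sub>M T"
  shows "indep_var S f T g"
proof -
  have AB: "sets A \<subseteq> events" "sets B \<subseteq> events" "\<And>a b. a \<in> sets A \<Longrightarrow> b \<in> sets B \<Longrightarrow> prob (a \<inter> b) = prob a * prob b"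
    using indep by (auto simp: indep_sets2_eq)
  have "f \<in> M \<rightarrow>\<^sub>M S" "g \<in> M \<rightarrow>\<^sub>M T"
    using f g AB(1,2) sp by (auto simp: measurable_def)
  moreover have f': "sigma_sets (space M) {f -` C \<inter> space M |C. C \<in> sets S} \<subseteq> sets A"
    using measurable_sets[OF f] unfolding sp(1)[symmetric] by (intro sets.sigma_sets_subset) auto
  moreover have g': "sigma_sets (space M) {g -` C \<inter> space M |C. C \<in> sets T} \<subseteq> sets B"
    using measurable_sets[OF g] unfolding sp(2)[symmetric] by (intro sets.sigma_sets_subset) auto
  ultimately show ?thesis
    unfolding indep_var_eq indep_sets2_eq
    using AB(3)[OF subsetD[OF f'] subsetD[OF g']] subset_trans[OF f' AB(1)] subset_trans[OF g' AB(2)] by blast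
qed

section \<open>The operator induced by the kernel on an admissible space\<close>

text \<open>Integration against Q, written directly as an integral against \<open>P\<close>. The
  agreement with \<open>Q_kernel_pow\<close> on \<open>F\<close> is
  \<open>Q_kernel_pow_integral\<close>.\<close>

definition mean_op :: "('s::metric_space \<Rightarrow> ('s \<times> 's) measure) \<Rightarrow> ('s \<Rightarrow> real) \<Rightarrow> 's \<Rightarrow> real" where
  "mean_op P f x = (\<integral>yz. f (fst yz) + f (snd yz) \<partial>P x) / 2"

section \<open>Integration against the kernel Q and its iterates\<close>

lemma ennreal_half: "ennreal (1/2) = inverse 2"
  by (metis divide_ennreal_def ennreal_1 ennreal_divide_numeral mult_1 zero_le_one)

text \<open>A fair coin chooses which daughter to follow. In this form the general formula for
  integrals against \<open>bind\<close> applies, while the definition by \<open>measure_of\<close>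
  only describes values on sets.\<close>

lemma Q_kernel_eq_bind_bernoulli:
  assumes P: "T_transition_probability P"
  shows "Q_kernel P x = measure_pmf (bernoulli_pmf (1/2)) \<bind> (\<lambda>b. if b then marginal0 P x else marginal1 P x)"
    and "(\<lambda>b. if b then marginal0 P x else marginal1 P x) \<in> measure_pmf (bernoulli_pmf (1/2)) \<rightarrow>\<^sub>M subprob_algebra borel"
proof -
  have Px: "prob_space (P x)" "sets (P x) = sets (borel \<Otimes>\<^sub>M borel)"
    using P by (auto simp: T_transition_probability_def)
  note [measurable_cong] = Px(2)
  have "prob_space (marginal0 P x)" "prob_space (marginal1 P x)"
    unfolding marginal0_def marginal1_def by (rule prob_space.prob_space_distr[OF Px(1)], measurable)+
  then show *: "(\<lambda>b. if b then marginal0 P x else marginal1 P x) \<in> measure_pmf (bernoulli_pmf (1/2)) \<rightarrow>\<^sub>M subprob_algebra borel"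
    by (auto simp: space_subprob_algebra prob_space_imp_subprob_space marginal0_def marginal1_def)
  show "Q_kernel P x = measure_pmf (bernoulli_pmf (1/2)) \<bind> (\<lambda>b. if b then marginal0 P x else marginal1 P x)"
  proof (rule measure_eqI)
    fix A assume "A \<in> sets (Q_kernel P x)"
    then have A: "A \<in> sets borel" by simp
    have "emeasure (measure_pmf (bernoulli_pmf (1/2)) \<bind> (\<lambda>b. if b then marginal0 P x else marginal1 P x)) A
        = (\<integral>\<^sup>+b. emeasure (if b then marginal0 P x else marginal1 P x) A \<partial>measure_pmf (bernoulli_pmf (1/2)))"
      by (rule emeasure_bind[OF _ * A]) simp
    also have "\<dots> = emeasure (Q_kernel P x) A"
      by (simp add: emeasure_Q_kernel[OF A] divide_ennreal_def add.commute ennreal_half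
          inverse_eq_divide distrib_left mult.commute)
    finally show "emeasure (Q_kernel P x) A = emeasure (measure_pmf (bernoulli_pmf (1/2)) \<bind> (\<lambda>b. if b then marginal0 P x else marginal1 P x)) A" ..
  qed (subst sets_bind[where N = borel], auto simp: marginal0_def marginal1_def)
qed

lemma nn_integral_Q_kernel:
  assumes P: "T_transition_probability P" and u [measurable]: "u \<in> borel_measurable borel"
  shows "(\<integral>\<^sup>+y. u y \<partial>Q_kernel P x) = (\<integral>\<^sup>+yz. u (fst yz) + u (snd yz) \<partial>P x) / 2"
proof -
  have Px: "sets (P x) = sets (borel \<Otimes>\<^sub>M borel)"
    using P by (auto simp: T_transition_probability_def)
  note [measurable_cong] = Px
  have "(\<integral>\<^sup>+y. u y \<partial>Q_kernel P x) = (\<integral>\<^sup>+y. u y \<partial>marginal0 P x) * (1/2) + (\<integral>\<^sup>+y. u y \<partial>marginal1 P x) * (1/2)"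
    unfolding Q_kernel_eq_bind_bernoulli(1)[OF P]
    by (subst nn_integral_bind[OF u Q_kernel_eq_bind_bernoulli(2)[OF P]])
       (simp add: divide_ennreal_def ennreal_half inverse_eq_divide mult.commute)
  also have "(\<integral>\<^sup>+y. u y \<partial>marginal0 P x) = (\<integral>\<^sup>+yz. u (fst yz) \<partial>P x)"
    unfolding marginal0_def by (rule nn_integral_distr) measurable
  also have "(\<integral>\<^sup>+y. u y \<partial>marginal1 P x) = (\<integral>\<^sup>+yz. u (snd yz) \<partial>P x)"
    unfolding marginal1_def by (rule nn_integral_distr) measurable
  finally show ?thesis
    by (subst nn_integral_add) (auto simp: divide_ennreal_def distrib_right)
qed

text \<open>Integrals against the \<open>bind\<close> in \<open>Q_kernel_pow\<close> require this.
  Integrating indicators expresses the mass of a fixed set as an integral against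
  \<open>P x\<close>, which is measurable in \<open>x\<close>.\<close>

lemma measurable_Q_kernel:
  assumes P: "T_transition_probability P"
  shows "Q_kernel P \<in> borel \<rightarrow>\<^sub>M subprob_algebra borel"
proof (rule measurable_subprob_algebra)
  note Pm = P[unfolded T_transition_probability_measurable]
  have Ps [measurable]: "P \<in> borel \<rightarrow>\<^sub>M subprob_algebra (borel \<Otimes>\<^sub>M borel)"
    using Pm by (rule measurable_prob_algebraD)
  show "subprob_space (Q_kernel P x)" for x
  proof (rule subprob_spaceI)
    have Px: "prob_space (P x)" "sets (P x) = sets (borel \<Otimes>\<^sub>M borel)"
      using P by (auto simp: T_transition_probability_def)
    note [measurable_cong] = Px(2)
    have sp: "space (Q_kernel P x) = UNIV" using sets_eq_imp_space_eq[OF sets_Q_kernel] by simp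
    have "emeasure (Q_kernel P x) (space (Q_kernel P x)) = (\<integral>\<^sup>+y. 1 \<partial>Q_kernel P x)"
      by simp
    also have "\<dots> = (1 + 1) / 2"
      using nn_integral_Q_kernel[OF P, of "\<lambda>_. 1" x] prob_space.emeasure_space_1[OF Px(1)]
      by simp
    finally show "emeasure (Q_kernel P x) (space (Q_kernel P x)) \<le> 1"
      by simp
    show "space (Q_kernel P x) \<noteq> {}" by (simp add: sp)
  qed
  show "(\<lambda>x. emeasure (Q_kernel P x) A) \<in> borel_measurable borel" if [measurable]: "A \<in> sets borel" for A
  proof -
    have "emeasure (Q_kernel P x) A = (\<integral>\<^sup>+yz. indicator A (fst yz) + indicator A (snd yz) \<partial>P x) / 2" for x
      using nn_integral_Q_kernel[OF P, of "indicator A" x] that by simp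
    then show ?thesis by simp
  qed
qed simp

lemma sets_Q_kernel_pow [simp]: "sets (Q_kernel_pow P r x) = sets borel"
proof (induction r)
  case (Suc r)
  from sets_eq_imp_space_eq[OF Suc] show ?case by (simp del: sets_Q_kernel add: sets_bind[OF sets_Q_kernel])
qed simp

lemma nn_integral_Q_kernel_pow_Suc:
  assumes P: "T_transition_probability P" and u: "u \<in> borel_measurable borel"
  shows "(\<integral>\<^sup>+y. u y \<partial>Q_kernel_pow P (Suc r) x) = (\<integral>\<^sup>+y. (\<integral>\<^sup>+z. u z \<partial>Q_kernel P y) \<partial>Q_kernel_pow P r x)"
proof -
  have "Q_kernel P \<in> Q_kernel_pow P r x \<rightarrow>\<^sub>M subprob_algebra borel"
    using measurable_Q_kernel[OF P] by (simp cong: measurable_cong_sets)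
  from nn_integral_bind[OF u this] show ?thesis by simp
qed

section \<open>Algebra and order properties of \<open>K\<close> on an admissible space\<close>

locale admissible_space =
  fixes P :: "'s::metric_space \<Rightarrow> ('s \<times> 's) measure" and \<nu> \<mu> :: "'s measure" and F :: "('s \<Rightarrow> real) set"
  assumes kernel: "T_transition_probability P"
    and admissible: "admissible P \<nu> \<mu> F"
begin

abbreviation K :: "('s \<Rightarrow> real) \<Rightarrow> 's \<Rightarrow> real" where "K \<equiv> mean_op P"

lemma F_measurable: "f \<in> F \<Longrightarrow> f \<in> borel_measurable borel"
  using admissible by (auto simp: admissible_def)

lemma F_add: "f \<in> F \<Longrightarrow> g \<in> F \<Longrightarrow> (\<lambda>x. f x + g x) \<in> F"
  and F_cmult: "f \<in> F \<Longrightarrow> (\<lambda>x. c * f x) \<in> F"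
  and F_const: "(\<lambda>x. c) \<in> F"
  and F_square: "f \<in> F \<Longrightarrow> (\<lambda>x. (f x)\<^sup>2) \<in> F"
  and F_integrable_\<nu>: "f \<in> F \<Longrightarrow> integrable \<nu> f"
  using admissible by (auto simp: admissible_def)

lemma F_tensor_integrable: "f \<in> F \<Longrightarrow> g \<in> F \<Longrightarrow> integrable (P x) (\<lambda>yz. f (fst yz) * g (snd yz))"
  and F_tensor: "f \<in> F \<Longrightarrow> g \<in> F \<Longrightarrow> (\<lambda>x. \<integral>yz. f (fst yz) * g (snd yz) \<partial>P x) \<in> F"
  using admissible by (auto simp: admissible_def tensor_def case_prod_beta')

lemma prob_space_P: "prob_space (P x)" and sets_P [measurable_cong]: "sets (P x) = sets (borel \<Otimes>\<^sub>M borel)"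
  using kernel by (auto simp: T_transition_probability_def)

text \<open>Admissibility speaks of products of functions of the two daughters; the constant 1 as
  second factor isolates one daughter. The same device puts \<open>K f\<close> into
  \<open>F\<close>.\<close>

lemma F_integrable_fst: "f \<in> F \<Longrightarrow> integrable (P x) (\<lambda>yz. f (fst yz))"
  using F_tensor_integrable[OF _ F_const[of 1]] by simp

lemma F_integrable_snd: "f \<in> F \<Longrightarrow> integrable (P x) (\<lambda>yz. f (snd yz))"
  using F_tensor_integrable[OF F_const[of 1]] by simp

lemma K_in_F: assumes "f \<in> F" shows "K f \<in> F"
proof -
  have "K f = (\<lambda>x. (1/2) * ((\<integral>yz. f (fst yz) * 1 \<partial>P x) + (\<integral>yz. 1 * f (snd yz) \<partial>P x)))"
    by (simp add: mean_op_def fun_eq_iff F_integrable_fst[OF assms] F_integrable_snd[OF assms])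
  also have "\<dots> \<in> F"
    by (intro F_cmult F_add F_tensor assms F_const)
  finally show ?thesis .
qed

lemma K_pow_in_F: "f \<in> F \<Longrightarrow> (K ^^ r) f \<in> F"
  by (induction r) (auto intro: K_in_F)

lemma K_add: "f \<in> F \<Longrightarrow> g \<in> F \<Longrightarrow> K (\<lambda>x. f x + g x) = (\<lambda>x. K f x + K g x)"
  by (simp add: mean_op_def fun_eq_iff F_integrable_fst F_integrable_snd field_simps)

lemma K_pow_add: "f \<in> F \<Longrightarrow> g \<in> F \<Longrightarrow> (K ^^ r) (\<lambda>x. f x + g x) = (\<lambda>x. (K ^^ r) f x + (K ^^ r) g x)"
  by (induction r) (auto simp: K_add K_pow_in_F)

lemma K_mono:
  assumes "f \<in> F" "g \<in> F" "\<And>x. f x \<le> g x"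
  shows "K f x \<le> K g x"
  unfolding mean_op_def using assms
  by (intro divide_right_mono integral_mono) (auto intro!: Bochner_Integration.integrable_add F_integrable_fst F_integrable_snd add_mono)

lemma K_pow_mono:
  assumes "f \<in> F" "g \<in> F" "\<And>x. f x \<le> g x"
  shows "(K ^^ r) f x \<le> (K ^^ r) g x"
  by (induction r arbitrary: x) (auto intro!: K_mono K_pow_in_F assms)

lemma K_pow_nonneg: "(\<And>x. 0 \<le> f x) \<Longrightarrow> 0 \<le> (K ^^ r) f x"
  by (induction r arbitrary: x) (auto simp: mean_op_def intro!: integral_nonneg)

lemma nn_integral_Q_kernel_F:
  assumes "u \<in> F" "\<And>x. 0 \<le> u x"
  shows "(\<integral>\<^sup>+y. u y \<partial>Q_kernel P x) = ennreal (K u x)"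
proof -
  have "(\<integral>\<^sup>+y. u y \<partial>Q_kernel P x) = (\<integral>\<^sup>+yz. ennreal (u (fst yz)) + ennreal (u (snd yz)) \<partial>P x) / 2"
    using F_measurable[OF assms(1)] by (intro nn_integral_Q_kernel kernel) measurable
  also have "(\<integral>\<^sup>+yz. ennreal (u (fst yz)) + ennreal (u (snd yz)) \<partial>P x) = (\<integral>\<^sup>+yz. ennreal (u (fst yz) + u (snd yz)) \<partial>P x)"
    using assms by simp
  also have "\<dots> = ennreal (\<integral>yz. u (fst yz) + u (snd yz) \<partial>P x)"
    using assms by (intro nn_integral_eq_integral) (auto simp: F_integrable_fst F_integrable_snd)
  also have "\<dots> / 2 = ennreal (K u x)"
    using assms by (simp add: mean_op_def divide_ennreal[symmetric] integral_nonneg)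
  finally show ?thesis .
qed

text \<open>\<open>Q_kernel_pow\<close> appends the new kernel at the end of the path, so
  integrating out the last step turns \<open>u\<close> into \<open>K u\<close>. The induction
  therefore runs over all nonnegative \<open>u\<close> in \<open>F\<close>.\<close>

lemma nn_integral_Q_kernel_pow_F:
  assumes "u \<in> F" "\<And>x. 0 \<le> u x"
  shows "(\<integral>\<^sup>+y. u y \<partial>Q_kernel_pow P r x) = ennreal ((K ^^ r) u x)"
  using assms
proof (induction r arbitrary: u)
  case 0
  then show ?case using F_measurable[OF 0(1)] by (simp add: nn_integral_return)
next
  case (Suc r)
  have "0 \<le> K u x" for x using K_pow_nonneg[of u 1] Suc.prems by simp
  with Suc show ?case
    using F_measurable[OF Suc.prems(1)]
    by (subst nn_integral_Q_kernel_pow_Suc[OF kernel])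
       (simp_all add: nn_integral_Q_kernel_F K_in_F funpow_Suc_right del: funpow.simps)
qed

text \<open>Neither positive parts nor absolute values need to stay in \<open>F\<close>; a function in \<open>F\<close> is
  instead the difference of the nonnegative elements \<open>1 + f\<^sup>2 + f\<close> and \<open>1 + f\<^sup>2\<close> of \<open>F\<close>.\<close>

lemma Q_kernel_pow_integral:
  assumes f: "f \<in> F"
  shows "(\<integral>y. f y \<partial>Q_kernel_pow P r x) = (K ^^ r) f x"
proof -
  define g where "g y = 1 + (f y)\<^sup>2" for y
  define h where "h y = g y + f y" for y
  have gF: "g \<in> F" unfolding g_def by (intro F_add F_const F_square f)
  then have hF: "h \<in> F" unfolding h_def by (intro F_add f)
  have g0: "0 \<le> g y" and h0: "0 \<le> h y" for y
  proof -
    have "h y = (f y + 1/2)\<^sup>2 + 3/4" by (simp add: h_def g_def power2_eq_square algebra_simps)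
    then show "0 \<le> h y" by simp
  qed (simp add: g_def)
  have *: "integrable (Q_kernel_pow P r x) u \<and> (\<integral>y. u y \<partial>Q_kernel_pow P r x) = (K ^^ r) u x"
    if "u \<in> F" "\<And>y. 0 \<le> u y" for u
    using F_measurable[OF that(1)] nn_integral_Q_kernel_pow_F[OF that, of r x] K_pow_nonneg[OF that(2)]
    by (auto intro!: integrableI_nonneg integral_eq_nn_integral[THEN trans] cong: measurable_cong_sets simp: that)
  have "(\<integral>y. f y \<partial>Q_kernel_pow P r x) = (\<integral>y. h y - g y \<partial>Q_kernel_pow P r x)"
    by (simp add: h_def)
  also have "\<dots> = (K ^^ r) h x - (K ^^ r) g x"
    using *[OF gF g0] *[OF hF h0] by simp
  also have "\<dots> = (K ^^ r) f x"
    using K_pow_add[OF gF f] by (simp add: h_def[abs_def])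
  finally show ?thesis .
qed

section \<open>Limits of the iterates of \<open>K\<close>\<close>

lemma K_pow_tendsto: "f \<in> F \<Longrightarrow> (\<lambda>r. (K ^^ r) f x) \<longlonglongrightarrow> (\<integral>y. f y \<partial>\<mu>)"
  using admissible by (auto simp: admissible_def Q_kernel_pow_integral)

lemma K_pow_bounded:
  assumes "f \<in> F"
  obtains g where "g \<in> F" "\<And>r x. \<bar>(K ^^ r) f x\<bar> \<le> g x"
  using admissible assms unfolding admissible_def
  by (metis (no_types, lifting) Q_kernel_pow_integral)

text \<open>Dominated convergence under each \<open>P x\<close>: as \<open>h\<close> lies in
  \<open>F\<close>, the sum of its values at the two daughters is an integrable majorant.\<close>

lemma K_tendsto_zero:
  assumes u: "\<And>r. u r \<in> F" "\<And>r x. \<bar>u r x\<bar> \<le> h x" and h: "h \<in> F" and lim: "\<And>x. (\<lambda>r. u r x) \<longlonglongrightarrow> 0"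
  shows "(\<lambda>r. K (u r) x) \<longlonglongrightarrow> 0"
proof -
  have "(\<lambda>r. (\<integral>yz. u r (fst yz) + u r (snd yz) \<partial>P x)) \<longlonglongrightarrow> (\<integral>yz. 0 \<partial>P x)"
  proof (rule integral_dominated_convergence[where w = "\<lambda>yz. h (fst yz) + h (snd yz)"])
    show "integrable (P x) (\<lambda>yz. h (fst yz) + h (snd yz))"
      by (intro Bochner_Integration.integrable_add F_integrable_fst F_integrable_snd h)
    show "(\<lambda>yz. u r (fst yz) + u r (snd yz)) \<in> borel_measurable (P x)" for r
      by (intro borel_measurable_integrable Bochner_Integration.integrable_add F_integrable_fst F_integrable_snd u)
    show "AE yz in P x. (\<lambda>r. u r (fst yz) + u r (snd yz)) \<longlonglongrightarrow> 0"
      using tendsto_add[OF lim lim] by (intro always_eventually) simp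
    show "AE yz in P x. norm (u r (fst yz) + u r (snd yz)) \<le> h (fst yz) + h (snd yz)" for r
      by (intro always_eventually allI) (metis abs_triangle_ineq add_mono order_trans real_norm_def u(2))
  qed simp
  then show ?thesis unfolding mean_op_def by (auto intro: tendsto_divide_zero)
qed

text \<open>For \<open>p = 0\<close> this is the squared convergence of the iterates to the mean 0.
  Each further \<open>K\<close> preserves the limit by \<open>K_tendsto_zero\<close>: if
  \<open>g\<close> dominates all iterates of \<open>f\<close>, then \<open>(K ^^ p)\<close> of the
  square of \<open>g\<close> is a majorant in \<open>F\<close>.\<close>

lemma K_pow_square_tendsto_zero:
  assumes f: "f \<in> F" and mean: "(\<integral>y. f y \<partial>\<mu>) = 0"
  shows "(\<lambda>r. (K ^^ p) (\<lambda>y. ((K ^^ r) f y)\<^sup>2) x) \<longlonglongrightarrow> 0"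
proof -
  obtain g where g: "g \<in> F" "\<And>r x. \<bar>(K ^^ r) f x\<bar> \<le> g x" using K_pow_bounded[OF f] by blast
  have sq: "(\<lambda>y. ((K ^^ r) f y)\<^sup>2) \<in> F" for r by (intro F_square K_pow_in_F f)
  have le: "((K ^^ r) f y)\<^sup>2 \<le> (g y)\<^sup>2" for r y
    using power_mono[OF g(2)[of r y], of 2] by simp
  show ?thesis
  proof (induction p arbitrary: x)
    case 0
    show ?case using tendsto_power[OF K_pow_tendsto[OF f], where n = 2] by (simp add: mean)
  next
    case (Suc p)
    have "(\<lambda>r. K ((K ^^ p) (\<lambda>y. ((K ^^ r) f y)\<^sup>2)) x) \<longlonglongrightarrow> 0"
    proof (rule K_tendsto_zero)
      show "\<bar>(K ^^ p) (\<lambda>y. ((K ^^ r) f y)\<^sup>2) x\<bar> \<le> (K ^^ p) (\<lambda>y. (g y)\<^sup>2) x" for r x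
        using K_pow_nonneg[of "\<lambda>y. ((K ^^ r) f y)\<^sup>2" p x] K_pow_mono[OF sq F_square[OF g(1)] le]
        by simp
    qed (auto intro: Suc K_pow_in_F sq F_square g)
    then show ?case by simp
  qed
qed

text \<open>The right-hand side of \<open>second_moment_le\<close> vanishes in the limit. Domination
  is used twice: \<open>g\<close> controls all \<open>(K ^^ r) f\<close>, and \<open>h\<close>
  controls all iterates of the square of \<open>g\<close>. So one \<open>\<nu>\<close>-integrable
  majorant is valid for all \<open>p\<close> and \<open>r\<close>.\<close>

lemma \<nu>_K_pow_square_convolution_tendsto_zero:
  assumes f: "f \<in> F" and mean: "(\<integral>y. f y \<partial>\<mu>) = 0"
  shows "(\<lambda>q. (\<integral>x. ((K ^^ q) f x)\<^sup>2 \<partial>\<nu>)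
    + (\<Sum>p<q. (1/2) ^ p * (\<integral>x. (K ^^ Suc p) (\<lambda>y. ((K ^^ (q - 1 - p)) f y)\<^sup>2) x \<partial>\<nu>))) \<longlonglongrightarrow> 0"
proof -
  define A where "A p r = (\<integral>x. (K ^^ p) (\<lambda>y. ((K ^^ r) f y)\<^sup>2) x \<partial>\<nu>)" for p r
  obtain g where g: "g \<in> F" "\<And>r x. \<bar>(K ^^ r) f x\<bar> \<le> g x" using K_pow_bounded[OF f] by blast
  obtain h where h: "h \<in> F" "\<And>r x. \<bar>(K ^^ r) (\<lambda>y. (g y)\<^sup>2) x\<bar> \<le> h x"
    using K_pow_bounded[OF F_square[OF g(1)]] by blast
  have sq: "(\<lambda>y. ((K ^^ r) f y)\<^sup>2) \<in> F" for r by (intro F_square K_pow_in_F f)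
  have le: "((K ^^ r) f y)\<^sup>2 \<le> (g y)\<^sup>2" for r y
    using power_mono[OF g(2)[of r y], of 2] by simp
  have bound: "\<bar>(K ^^ p) (\<lambda>y. ((K ^^ r) f y)\<^sup>2) x\<bar> \<le> h x" for p r x
    using K_pow_nonneg[of "\<lambda>y. ((K ^^ r) f y)\<^sup>2" p x] K_pow_mono[OF sq F_square[OF g(1)] le, of p r x] h(2)[of p x]
    by simp
  have lim: "A p \<longlonglongrightarrow> 0" for p
  proof -
    have "(\<lambda>r. A p r) \<longlonglongrightarrow> (\<integral>x. 0 \<partial>\<nu>)"
      unfolding A_def
      by (rule integral_dominated_convergence[where w = h])
         (auto intro!: borel_measurable_integrable F_integrable_\<nu> K_pow_in_F sq h bound K_pow_square_tendsto_zero f mean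
            simp del: abs_le_iff)
    then show ?thesis by simp
  qed
  have "\<bar>A p r\<bar> \<le> (\<integral>x. h x \<partial>\<nu>)" for p r
    unfolding A_def by (intro abs_integral_le_integral F_integrable_\<nu> K_pow_in_F sq h bound)
  \<comment> \<open>The initial term is \<open>A 0 q\<close>; the convolution uses the shifted array
    because each diagonal error carries at least one factor \<open>K\<close>.\<close>
  from tendsto_geometric_convolution_zero[of "\<lambda>p. A (Suc p)", OF this lim]
  have "(\<lambda>q. A 0 q + (\<Sum>p<q. (1/2) ^ p * A (Suc p) (q - 1 - p))) \<longlonglongrightarrow> 0 + 0"
    by (intro tendsto_add lim)
  then show ?thesis by (simp add: A_def)
qed

end

section \<open>Second moments along the tree\<close>

locale admissible_bifurcating_markov_chain =
  bifurcating_markov_chain M Fil X \<nu> P + admissible_space P \<nu> \<mu> F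
  for M :: "'w measure" and Fil and X :: "nat \<Rightarrow> 'w \<Rightarrow> 's::metric_space" and \<nu> P \<mu> F
begin

section \<open>The branching property under the integral\<close>

definition daughters :: "nat \<Rightarrow> 'w \<Rightarrow> 's \<times> 's" where
  "daughters n \<omega> = (X (2 * n) \<omega>, X (2 * n + 1) \<omega>)"

lemma X_measurable: "n \<ge> 1 \<Longrightarrow> X n \<in> M \<rightarrow>\<^sub>M borel"
  using measurable_from_subalg[OF subalgebra_Fil adapted] by blast

lemma daughters_measurable: "n \<ge> 1 \<Longrightarrow> daughters n \<in> M \<rightarrow>\<^sub>M borel \<Otimes>\<^sub>M borel"
  unfolding daughters_def[abs_def] by (intro measurable_Pair X_measurable) auto

lemma P_measurable: "P \<in> borel \<rightarrow>\<^sub>M subprob_algebra (borel \<Otimes>\<^sub>M borel)"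
  using transition unfolding T_transition_probability_measurable by (rule measurable_prob_algebraD)

lemma P_X_measurable: "n \<ge> 1 \<Longrightarrow> (\<lambda>\<omega>. P (X n \<omega>)) \<in> M \<rightarrow>\<^sub>M subprob_algebra (borel \<Otimes>\<^sub>M borel)"
  by (rule measurable_compose[OF X_measurable P_measurable])

text \<open>Conditional expectation preserves the integral, so the branching property can be
  integrated; boundedness of the factors supplies integrability.\<close>

lemma integral_prod_branching:
  fixes f :: "nat \<Rightarrow> 's \<times> 's \<Rightarrow> real"
  assumes f: "\<And>n. n \<in> generation q \<Longrightarrow> f n \<in> borel_measurable (borel \<Otimes>\<^sub>M borel) \<and> bounded (range (f n))"
  shows "(\<integral>\<omega>. (\<Prod>n\<in>generation q. f n (daughters n \<omega>)) \<partial>M)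
    = (\<integral>\<omega>. (\<Prod>n\<in>generation q. \<integral>yz. f n yz \<partial>P (X n \<omega>)) \<partial>M)"
proof -
  interpret finite_measure_subalgebra M "Fil q"
    by unfold_locales (rule subalgebra_Fil)
  have "\<forall>n\<in>generation q. \<exists>B. \<forall>yz. \<bar>f n yz\<bar> \<le> B"
    using f by (force simp: bounded_iff)
  then obtain B where B: "\<And>n yz. n \<in> generation q \<Longrightarrow> \<bar>f n yz\<bar> \<le> B n" by metis
  have meas: "(\<lambda>\<omega>. \<Prod>n\<in>generation q. f n (daughters n \<omega>)) \<in> borel_measurable M"
    using f by (intro borel_measurable_prod measurable_compose[OF daughters_measurable]) (auto simp: mem_generation_iff)
  have int: "integrable M (\<lambda>\<omega>. \<Prod>n\<in>generation q. f n (daughters n \<omega>))"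
    by (intro integrable_const_bound[where B = "\<Prod>n\<in>generation q. B n"] meas AE_I2)
      (auto simp: abs_prod intro!: prod_mono B)
  have "(\<integral>\<omega>. (\<Prod>n\<in>generation q. f n (daughters n \<omega>)) \<partial>M)
      = (\<integral>\<omega>. real_cond_exp M (Fil q) (\<lambda>\<omega>. \<Prod>n\<in>generation q. f n (daughters n \<omega>)) \<omega> \<partial>M)"
    using real_cond_exp_int(2)[OF int] by simp
  also have "\<dots> = (\<integral>\<omega>. (\<Prod>n\<in>generation q. \<integral>yz. f n yz \<partial>P (X n \<omega>)) \<partial>M)"
  proof (rule integral_cong_AE)
    show "(\<lambda>\<omega>. \<Prod>n\<in>generation q. \<integral>yz. f n yz \<partial>P (X n \<omega>)) \<in> borel_measurable M"
      using f by (intro borel_measurable_prod measurable_compose[OF P_X_measurable integral_measurable_subprob_algebra])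
        (auto simp: mem_generation_iff)
  qed (use branching[OF f] in \<open>auto simp: daughters_def\<close>)
  finally show ?thesis .
qed

text \<open>All factors of the branching product other than that of \<open>n\<close> are taken to be
  the constant 1, which each \<open>P x\<close> integrates to 1.\<close>

lemma integral_branching:
  fixes u :: "'s \<times> 's \<Rightarrow> real"
  assumes n: "n \<ge> 1" and u: "u \<in> borel_measurable (borel \<Otimes>\<^sub>M borel)" "bounded (range u)"
  shows "(\<integral>\<omega>. u (daughters n \<omega>) \<partial>M) = (\<integral>\<omega>. (\<integral>yz. u yz \<partial>P (X n \<omega>)) \<partial>M)"
proof -
  define f where "f j = (if j = n then u else (\<lambda>_. 1))" for j
  have n: "n \<in> generation (gen_of n)" using n by (simp add: mem_generation_iff)
  have *: "(\<Prod>j\<in>generation (gen_of n). f j (daughters j \<omega>)) = u (daughters n \<omega>)" for \<omega>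
    using n by (subst prod.remove[OF _ n]) (auto simp: f_def intro!: prod.neutral)
  have "(\<integral>yz. f j yz \<partial>P x) = 1" if "j \<noteq> n" for j x
    using that prob_space.prob_space[OF prob_space_P[of x]] by (simp add: f_def)
  then have **: "(\<Prod>j\<in>generation (gen_of n). \<integral>yz. f j yz \<partial>P (X j \<omega>)) = (\<integral>yz. u yz \<partial>P (X n \<omega>))" for \<omega>
    using n by (subst prod.remove[OF _ n]) (auto intro!: prod.neutral, simp add: f_def)
  show ?thesis
    using integral_prod_branching[of "gen_of n" f] u unfolding * ** by (simp add: f_def)
qed

text \<open>The same choice with two nonconstant factors. Both vertices lie in one generation, since
  the branching property treats a whole generation at once.\<close>

lemma integral_branching_pair:
  fixes u v :: "'s \<times> 's \<Rightarrow> real"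
  assumes n: "n \<in> generation q" and m: "m \<in> generation q" and nm: "n \<noteq> m"
    and u: "u \<in> borel_measurable (borel \<Otimes>\<^sub>M borel)" "bounded (range u)"
    and v: "v \<in> borel_measurable (borel \<Otimes>\<^sub>M borel)" "bounded (range v)"
  shows "(\<integral>\<omega>. u (daughters n \<omega>) * v (daughters m \<omega>) \<partial>M)
    = (\<integral>\<omega>. (\<integral>yz. u yz \<partial>P (X n \<omega>)) * (\<integral>yz. v yz \<partial>P (X m \<omega>)) \<partial>M)"
proof -
  define f where "f j = (if j = n then u else if j = m then v else (\<lambda>_. 1))" for j
  have m': "m \<in> generation q - {n}" using m nm by simp
  have *: "(\<Prod>j\<in>generation q. h j) = h n * h m" if "\<And>j. j \<noteq> n \<Longrightarrow> j \<noteq> m \<Longrightarrow> h j = 1" for h :: "nat \<Rightarrow> real"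
    using that by (subst prod.remove[OF _ n], simp, subst prod.remove[OF _ m']) (auto intro!: prod.neutral)
  have L: "(\<Prod>j\<in>generation q. f j (daughters j \<omega>)) = u (daughters n \<omega>) * v (daughters m \<omega>)" for \<omega>
    using nm by (subst *) (auto simp: f_def)
  have "(\<integral>yz. f j yz \<partial>P x) = 1" if "j \<noteq> n" "j \<noteq> m" for j x
    using that prob_space.prob_space[OF prob_space_P[of x]] by (simp add: f_def)
  then have R: "(\<Prod>j\<in>generation q. \<integral>yz. f j yz \<partial>P (X j \<omega>))
      = (\<integral>yz. u yz \<partial>P (X n \<omega>)) * (\<integral>yz. v yz \<partial>P (X m \<omega>))" for \<omega>
    using nm by (subst *) (auto, auto simp: f_def)
  show ?thesis
    using integral_prod_branching[of q f] u v unfolding L R by (simp add: f_def)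
qed

text \<open>The bounded identity for indicators determines the joint law of the daughters. Through
  this law, nonnegative unbounded functions become accessible without any truncation.\<close>

lemma distr_daughters:
  assumes n: "n \<ge> 1"
  shows "distr M (borel \<Otimes>\<^sub>M borel) (daughters n) = distr M borel (X n) \<bind> P"
proof (rule measure_eqI)
  have Pn: "P \<in> distr M borel (X n) \<rightarrow>\<^sub>M subprob_algebra (borel \<Otimes>\<^sub>M borel)"
    using P_measurable by simp
  have sb: "sets (distr M borel (X n) \<bind> P) = sets (borel \<Otimes>\<^sub>M borel)"
    by (rule sets_bind) (auto simp: sets_P)
  show "sets (distr M (borel \<Otimes>\<^sub>M borel) (daughters n)) = sets (distr M borel (X n) \<bind> P)"
    by (simp add: sb)
  fix A assume "A \<in> sets (distr M (borel \<Otimes>\<^sub>M borel) (daughters n))"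
  then have A [measurable]: "A \<in> sets (borel \<Otimes>\<^sub>M borel)" by simp
  note [measurable] = daughters_measurable[OF n] P_X_measurable[OF n]
  have int: "integrable M (\<lambda>\<omega>. measure (P (X n \<omega>)) A)"
    using measurable_compose[OF P_X_measurable[OF n] measurable_measure_subprob_algebra[OF A]]
    by (intro integrable_const_bound[where B = 1]) (auto simp: prob_space.prob_le_1[OF prob_space_P])
  have "bounded (range (indicator A :: _ \<Rightarrow> real))" by (auto simp: bounded_iff indicator_def intro!: exI[of _ 1])
  from integral_branching[OF n _ this]
  have "prob (daughters n -` A \<inter> space M) = (\<integral>\<omega>. measure (P (X n \<omega>)) A \<partial>M)"
    by (simp add: indicator_vimage[symmetric] sets_P Int_absorb2 sets.sets_into_space
        sets_eq_imp_space_eq[OF sets_P])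
  moreover have "emeasure (P x) A = ennreal (measure (P x) A)" for x
    using prob_space_P[of x] by (simp add: prob_space_def finite_measure.emeasure_eq_measure)
  moreover have "(\<integral>\<^sup>+x. emeasure (P x) A \<partial>distr M borel (X n)) = (\<integral>\<^sup>+\<omega>. emeasure (P (X n \<omega>)) A \<partial>M)"
    by (rule nn_integral_distr[OF X_measurable[OF n]])
      (simp add: measurable_compose[OF P_measurable measurable_emeasure_subprob_algebra[OF A]])
  ultimately show "emeasure (distr M (borel \<Otimes>\<^sub>M borel) (daughters n)) A = emeasure (distr M borel (X n) \<bind> P) A"
    using nn_integral_eq_integral[OF int]
    by (subst emeasure_bind[OF _ Pn A])
      (simp_all add: emeasure_distr emeasure_eq_measure)
qed

section \<open>Sums over a generation and integrability along the tree\<close>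

lemma nn_integral_daughters_F:
  assumes n: "n \<ge> 1" and u: "u \<in> F" "\<And>x. 0 \<le> u x"
  shows "(\<integral>\<^sup>+\<omega>. u (X (2 * n) \<omega>) \<partial>M) + (\<integral>\<^sup>+\<omega>. u (X (2 * n + 1) \<omega>) \<partial>M) = 2 * (\<integral>\<^sup>+\<omega>. K u (X n \<omega>) \<partial>M)"
proof -
  have [measurable]: "u \<in> borel_measurable borel" using u by (simp add: F_measurable)
  have [measurable]: "K u \<in> borel_measurable borel" using u by (simp add: F_measurable K_in_F)
  note [measurable] = X_measurable[OF n] X_measurable[of "2 * n"] X_measurable[of "Suc (2 * n)"] daughters_measurable[OF n]
  define \<phi> where "\<phi> = (\<lambda>yz. ennreal (u (fst yz)) + ennreal (u (snd yz)))"
  have \<phi>: "\<phi> \<in> borel_measurable (borel \<Otimes>\<^sub>M borel)" unfolding \<phi>_def by measurable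
  have Pn: "P \<in> distr M borel (X n) \<rightarrow>\<^sub>M subprob_algebra (borel \<Otimes>\<^sub>M borel)"
    using P_measurable by simp
  have P\<phi>: "(\<integral>\<^sup>+yz. \<phi> yz \<partial>P x) = 2 * ennreal (K u x)" for x
  proof -
    have "(\<integral>\<^sup>+yz. \<phi> yz \<partial>P x) / 2 = ennreal (K u x)"
      unfolding \<phi>_def nn_integral_Q_kernel_F[OF u, symmetric]
      by (rule nn_integral_Q_kernel[OF kernel, symmetric]) measurable
    then have "2 * ennreal (K u x) = 2 * ((\<integral>\<^sup>+yz. \<phi> yz \<partial>P x) / 2)" by simp
    also have "\<dots> = (\<integral>\<^sup>+yz. \<phi> yz \<partial>P x) * 2 / 2" by (simp add: ennreal_times_divide mult.commute)
    finally show ?thesis by (simp add: mult_divide_eq_ennreal)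
  qed
  have "(\<integral>\<^sup>+\<omega>. u (X (2 * n) \<omega>) \<partial>M) + (\<integral>\<^sup>+\<omega>. u (X (2 * n + 1) \<omega>) \<partial>M) = (\<integral>\<^sup>+\<omega>. \<phi> (daughters n \<omega>) \<partial>M)"
    using n by (simp add: \<phi>_def daughters_def nn_integral_add)
  also have "\<dots> = (\<integral>\<^sup>+yz. \<phi> yz \<partial>(distr M borel (X n) \<bind> P))"
    unfolding distr_daughters[OF n, symmetric] by (subst nn_integral_distr) (simp_all add: \<phi> daughters_measurable[OF n])
  also have "\<dots> = (\<integral>\<^sup>+x. (\<integral>\<^sup>+yz. \<phi> yz \<partial>P x) \<partial>distr M borel (X n))"
    by (rule nn_integral_bind[OF \<phi> Pn])
  also have "\<dots> = (\<integral>\<^sup>+x. 2 * ennreal (K u x) \<partial>distr M borel (X n))" by (simp only: P\<phi>)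
  also have "\<dots> = 2 * (\<integral>\<^sup>+\<omega>. K u (X n \<omega>) \<partial>M)"
    by (subst nn_integral_distr) (auto simp: nn_integral_cmult)
  finally show ?thesis .
qed

text \<open>A many-to-one formula: passing from daughters to mothers replaces \<open>u\<close> by
  \<open>K u\<close> and yields a factor 2. Extended nonnegative integrals are used because
  integrability along the tree is only deduced from this formula.\<close>

lemma nn_integral_generation_F:
  assumes "u \<in> F" "\<And>x. 0 \<le> u x"
  shows "(\<Sum>n\<in>generation q. \<integral>\<^sup>+\<omega>. u (X n \<omega>) \<partial>M) = 2 ^ q * (\<integral>\<^sup>+x. (K ^^ q) u x \<partial>\<nu>)"
  using assms
proof (induction q arbitrary: u)
  case 0
  have "generation 0 = {1}" by (auto simp: generation_def)
  then show ?case
    using F_measurable[OF 0(1)] by (simp add: initial[symmetric] nn_integral_distr X_measurable)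
next
  case (Suc q)
  have K0: "0 \<le> K u x" for x using K_pow_nonneg[of u 1] Suc.prems by simp
  have "(\<Sum>n\<in>generation (Suc q). \<integral>\<^sup>+\<omega>. u (X n \<omega>) \<partial>M) = (\<Sum>n\<in>generation q. 2 * (\<integral>\<^sup>+\<omega>. K u (X n \<omega>) \<partial>M))"
    unfolding sum_generation_Suc
    by (intro sum.cong refl nn_integral_daughters_F Suc.prems) (simp add: mem_generation_iff)
  also have "\<dots> = 2 * (2 ^ q * (\<integral>\<^sup>+x. (K ^^ q) (K u) x \<partial>\<nu>))"
    unfolding sum_distrib_left[symmetric] by (subst Suc.IH) (auto intro: K_in_F Suc.prems K0)
  finally show ?case by (simp add: funpow_Suc_right mult.assoc del: funpow.simps)
qed

text \<open>A single vertex contributes at most the total of its generation, which is finite because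
  the iterates of \<open>K\<close> keep \<open>u\<close> in \<open>F\<close> and all of
  \<open>F\<close> is \<open>\<nu>\<close>-integrable.\<close>

lemma integrable_nonneg_F:
  assumes u: "u \<in> F" "\<And>x. 0 \<le> u x" and n: "n \<ge> 1"
  shows "integrable M (\<lambda>\<omega>. u (X n \<omega>))"
proof (rule integrableI_nonneg)
  show "(\<lambda>\<omega>. u (X n \<omega>)) \<in> borel_measurable M"
    by (rule measurable_compose[OF X_measurable[OF n] F_measurable[OF u(1)]])
  have int: "integrable \<nu> ((K ^^ gen_of n) u)" by (intro F_integrable_\<nu> K_pow_in_F u)
  have "(\<integral>\<^sup>+\<omega>. u (X n \<omega>) \<partial>M) \<le> (\<Sum>j\<in>generation (gen_of n). \<integral>\<^sup>+\<omega>. u (X j \<omega>) \<partial>M)"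
    using n by (intro member_le_sum) (auto simp: mem_generation_iff)
  also have "\<dots> = 2 ^ gen_of n * ennreal (\<integral>x. (K ^^ gen_of n) u x \<partial>\<nu>)"
    unfolding nn_integral_generation_F[OF u]
    using K_pow_nonneg[OF u(2)] by (subst nn_integral_eq_integral[OF int]) auto
  also have "\<dots> < \<infinity>" by (simp add: ennreal_mult_less_top power_less_top_ennreal)
  finally show "(\<integral>\<^sup>+\<omega>. u (X n \<omega>) \<partial>M) < \<infinity>" .
qed (use u in simp)

lemma integral_generation_F:
  assumes u: "u \<in> F" "\<And>x. 0 \<le> u x"
  shows "(\<Sum>n\<in>generation q. \<integral>\<omega>. u (X n \<omega>) \<partial>M) = 2 ^ q * (\<integral>x. (K ^^ q) u x \<partial>\<nu>)"
proof -
  have int: "integrable \<nu> ((K ^^ q) u)" by (intro F_integrable_\<nu> K_pow_in_F u)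
  have "ennreal (\<Sum>n\<in>generation q. \<integral>\<omega>. u (X n \<omega>) \<partial>M) = (\<Sum>n\<in>generation q. \<integral>\<^sup>+\<omega>. u (X n \<omega>) \<partial>M)"
    by (subst sum_ennreal[symmetric], simp add: u)
      (intro sum.cong refl nn_integral_eq_integral[symmetric] integrable_nonneg_F u; auto simp: mem_generation_iff u)
  also have "\<dots> = 2 ^ q * ennreal (\<integral>x. (K ^^ q) u x \<partial>\<nu>)"
    unfolding nn_integral_generation_F[OF u]
    using K_pow_nonneg[OF u(2)] by (subst nn_integral_eq_integral[OF int]) auto
  also have "\<dots> = ennreal (2 ^ q * (\<integral>x. (K ^^ q) u x \<partial>\<nu>))"
    by (simp add: ennreal_mult' ennreal_power[symmetric])
  finally show ?thesis
    using K_pow_nonneg[OF u(2)] u by (subst (asm) ennreal_inj) (auto intro!: sum_nonneg integral_nonneg)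
qed

lemma square_integrable_F:
  assumes "f \<in> F" "n \<ge> 1"
  shows "square_integrable M (\<lambda>\<omega>. f (X n \<omega>))"
  using integrable_nonneg_F[OF F_square[OF assms(1)] _ assms(2)]
    measurable_compose[OF X_measurable[OF assms(2)] F_measurable[OF assms(1)]]
  by (simp add: square_integrable_def)

text \<open>The branching property only concerns bounded functions, hence the truncation \<open>\<phi>'\<close>; the conditional
  means of the truncations are dominated by \<open>c = 2 * K (1 + f\<^sup>2)\<close>, which again belongs to \<open>F\<close>.\<close>

lemma integral_daughters_pair_F:
  assumes n: "n \<in> generation q" and m: "m \<in> generation q" and nm: "n \<noteq> m" and f: "f \<in> F"
  shows "(\<integral>\<omega>. (f (X (2 * n) \<omega>) + f (X (2 * n + 1) \<omega>)) * (f (X (2 * m) \<omega>) + f (X (2 * m + 1) \<omega>)) \<partial>M)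
    = (\<integral>\<omega>. (2 * K f (X n \<omega>)) * (2 * K f (X m \<omega>)) \<partial>M)"
proof -
  have nm1: "n \<ge> 1" "m \<ge> 1" using n m by (auto simp: mem_generation_iff)
  define \<phi> where "\<phi> yz = f (fst yz) + f (snd yz)" for yz
  define \<phi>' where "\<phi>' k yz = max (- real k) (min (real k) (\<phi> yz))" for k yz
  define c where "c x = 2 * K (\<lambda>y. 1 + (f y)\<^sup>2) x" for x
  have [measurable]: "f \<in> borel_measurable borel" by (rule F_measurable[OF f])
  have \<phi>_meas [measurable]: "\<phi> \<in> borel_measurable (borel \<Otimes>\<^sub>M borel)" unfolding \<phi>_def by measurable
  have \<phi>'_meas [measurable]: "\<phi>' k \<in> borel_measurable (borel \<Otimes>\<^sub>M borel)" for k unfolding \<phi>'_def by measurable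
  note [measurable] = daughters_measurable[OF nm1(1)] daughters_measurable[OF nm1(2)]
    P_X_measurable[OF nm1(1)] P_X_measurable[OF nm1(2)]
  have \<phi>'_le: "\<bar>\<phi>' k yz\<bar> \<le> \<bar>\<phi> yz\<bar>" for k yz by (auto simp: \<phi>'_def)
  have \<phi>'_bounded: "bounded (range (\<phi>' k))" for k
    by (auto simp: bounded_iff \<phi>'_def intro!: exI[of _ "real k"])
  have \<phi>'_lim: "(\<lambda>k. \<phi>' k yz) \<longlonglongrightarrow> \<phi> yz" for yz
  proof (rule tendsto_eventually)
    show "\<forall>\<^sub>F k in sequentially. \<phi>' k yz = \<phi> yz"
      using eventually_ge_at_top[of "nat \<lceil>\<bar>\<phi> yz\<bar>\<rceil>"]
      by eventually_elim (auto simp: \<phi>'_def nat_le_iff ceiling_le_iff)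
  qed
  have F2: "(\<lambda>y. 1 + (f y)\<^sup>2) \<in> F" by (intro F_add F_const F_square f)
  have cF: "c \<in> F" unfolding c_def by (intro F_cmult K_in_F F2)
  have c_eq: "c x = (\<integral>yz. (1 + (f (fst yz))\<^sup>2) + (1 + (f (snd yz))\<^sup>2) \<partial>P x)" for x
    by (simp add: c_def mean_op_def)
  have c_int: "integrable (P x) (\<lambda>yz. (1 + (f (fst yz))\<^sup>2) + (1 + (f (snd yz))\<^sup>2))" for x
    by (intro Bochner_Integration.integrable_add F_integrable_fst[OF F2] F_integrable_snd[OF F2])
  have abs_le: "\<bar>a\<bar> \<le> 1 + a\<^sup>2" for a :: real
  proof -
    have "0 \<le> (\<bar>a\<bar> - 1/2)\<^sup>2" by simp
    then show ?thesis by (simp add: power2_diff power_divide)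
  qed
  have \<phi>_le: "\<bar>\<phi> yz\<bar> \<le> (1 + (f (fst yz))\<^sup>2) + (1 + (f (snd yz))\<^sup>2)" for yz
    using abs_le[of "f (fst yz)"] abs_le[of "f (snd yz)"] by (simp add: \<phi>_def)
  have P\<phi>'_lim: "(\<lambda>k. \<integral>yz. \<phi>' k yz \<partial>P x) \<longlonglongrightarrow> 2 * K f x" for x
  proof -
    have "(\<lambda>k. \<integral>yz. \<phi>' k yz \<partial>P x) \<longlonglongrightarrow> (\<integral>yz. \<phi> yz \<partial>P x)"
    proof (rule integral_dominated_convergence[OF _ _ c_int])
      show "AE yz in P x. norm (\<phi>' k yz) \<le> (1 + (f (fst yz))\<^sup>2) + (1 + (f (snd yz))\<^sup>2)" for k
        unfolding real_norm_def by (intro AE_I2 order_trans[OF \<phi>'_le \<phi>_le])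
    qed (auto intro!: \<phi>'_lim)
    then show ?thesis by (simp add: mean_op_def \<phi>_def)
  qed
  have P\<phi>'_le: "\<bar>\<integral>yz. \<phi>' k yz \<partial>P x\<bar> \<le> c x" for k x
  proof -
    have "integrable (P x) (\<phi>' k)"
    proof (rule Bochner_Integration.integrable_bound[OF c_int])
      show "AE yz in P x. norm (\<phi>' k yz) \<le> norm ((1 + (f (fst yz))\<^sup>2) + (1 + (f (snd yz))\<^sup>2))"
        unfolding real_norm_def by (intro AE_I2 order_trans[OF order_trans[OF \<phi>'_le \<phi>_le] abs_ge_self])
    qed measurable
    then show ?thesis
      unfolding c_eq
      by (intro abs_integral_le_integral c_int order_trans[OF \<phi>'_le \<phi>_le])
  qed
  have \<phi>_si: "square_integrable M (\<lambda>\<omega>. \<phi> (daughters j \<omega>))" if "j \<ge> 1" for j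
    unfolding \<phi>_def daughters_def fst_conv snd_conv using that
    by (intro square_integrable_add square_integrable_F f) auto
  \<comment> \<open>Both sides of the identity for the truncations pass to the limit: the left one
    is dominated by the untruncated product, the right one by
    \<open>c (X n \<omega>) * c (X m \<omega>)\<close>.\<close>
  have L: "(\<lambda>k. \<integral>\<omega>. \<phi>' k (daughters n \<omega>) * \<phi>' k (daughters m \<omega>) \<partial>M)
      \<longlonglongrightarrow> (\<integral>\<omega>. \<phi> (daughters n \<omega>) * \<phi> (daughters m \<omega>) \<partial>M)"
  proof (rule integral_dominated_convergence)
    show "integrable M (\<lambda>\<omega>. \<bar>\<phi> (daughters n \<omega>) * \<phi> (daughters m \<omega>)\<bar>)"
      by (intro integrable_abs square_integrable_mult \<phi>_si nm1)
    show "AE \<omega> in M. (\<lambda>k. \<phi>' k (daughters n \<omega>) * \<phi>' k (daughters m \<omega>)) \<longlonglongrightarrow> \<phi> (daughters n \<omega>) * \<phi> (daughters m \<omega>)"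
      by (intro always_eventually allI tendsto_mult \<phi>'_lim)
    show "AE \<omega> in M. norm (\<phi>' k (daughters n \<omega>) * \<phi>' k (daughters m \<omega>)) \<le> \<bar>\<phi> (daughters n \<omega>) * \<phi> (daughters m \<omega>)\<bar>" for k
      by (intro always_eventually allI) (auto simp: abs_mult intro!: mult_mono \<phi>'_le)
  qed measurable
  have R: "(\<lambda>k. \<integral>\<omega>. (\<integral>yz. \<phi>' k yz \<partial>P (X n \<omega>)) * (\<integral>yz. \<phi>' k yz \<partial>P (X m \<omega>)) \<partial>M)
      \<longlonglongrightarrow> (\<integral>\<omega>. (2 * K f (X n \<omega>)) * (2 * K f (X m \<omega>)) \<partial>M)"
  proof (rule integral_dominated_convergence)
    show "integrable M (\<lambda>\<omega>. c (X n \<omega>) * c (X m \<omega>))"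
      by (intro square_integrable_mult square_integrable_F cF nm1)
    show "AE \<omega> in M. (\<lambda>k. (\<integral>yz. \<phi>' k yz \<partial>P (X n \<omega>)) * (\<integral>yz. \<phi>' k yz \<partial>P (X m \<omega>))) \<longlonglongrightarrow> (2 * K f (X n \<omega>)) * (2 * K f (X m \<omega>))"
      by (intro always_eventually allI tendsto_mult P\<phi>'_lim)
    show "AE \<omega> in M. norm ((\<integral>yz. \<phi>' k yz \<partial>P (X n \<omega>)) * (\<integral>yz. \<phi>' k yz \<partial>P (X m \<omega>))) \<le> c (X n \<omega>) * c (X m \<omega>)" for k
      using P\<phi>'_le by (intro always_eventually allI) (auto simp: abs_mult intro!: mult_mono order_trans[OF abs_ge_zero P\<phi>'_le])
    have "K f \<in> borel_measurable borel" by (intro F_measurable K_in_F f)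
    then show "(\<lambda>\<omega>. (2 * K f (X n \<omega>)) * (2 * K f (X m \<omega>))) \<in> borel_measurable M"
      using measurable_compose[OF X_measurable[OF nm1(1)]] measurable_compose[OF X_measurable[OF nm1(2)]]
      by (intro borel_measurable_times) auto
    show "(\<lambda>\<omega>. (\<integral>yz. \<phi>' k yz \<partial>P (X n \<omega>)) * (\<integral>yz. \<phi>' k yz \<partial>P (X m \<omega>))) \<in> borel_measurable M" for k
      by (intro borel_measurable_times measurable_compose[OF P_X_measurable integral_measurable_subprob_algebra] nm1 \<phi>'_meas)
  qed
  have "(\<lambda>k. \<integral>\<omega>. \<phi>' k (daughters n \<omega>) * \<phi>' k (daughters m \<omega>) \<partial>M)
      \<longlonglongrightarrow> (\<integral>\<omega>. (2 * K f (X n \<omega>)) * (2 * K f (X m \<omega>)) \<partial>M)"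
    using R unfolding integral_branching_pair[OF n m nm \<phi>'_meas \<phi>'_bounded \<phi>'_meas \<phi>'_bounded] .
  with L have "(\<integral>\<omega>. \<phi> (daughters n \<omega>) * \<phi> (daughters m \<omega>) \<partial>M) = (\<integral>\<omega>. (2 * K f (X n \<omega>)) * (2 * K f (X m \<omega>)) \<partial>M)"
    by (rule LIMSEQ_unique)
  then show ?thesis by (simp add: \<phi>_def daughters_def)
qed

section \<open>Recursion for the second moments of generation sums\<close>

definition second_moment :: "nat \<Rightarrow> ('s \<Rightarrow> real) \<Rightarrow> real" where
  "second_moment q f = (\<integral>\<omega>. (\<Sum>n\<in>generation q. f (X n \<omega>))\<^sup>2 \<partial>M)"

text \<open>Conditionally on \<open>Fil q\<close> the summands over the pairs of daughters are independent with means
  \<open>2 * K f (X n)\<close>, so replacing them by these means only affects the diagonal.\<close>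

lemma second_moment_Suc_le:
  assumes f: "f \<in> F"
  shows "second_moment (Suc q) f \<le> 4 * second_moment q (K f) + 4 * 2 ^ q * (\<integral>x. (K ^^ Suc q) (\<lambda>y. (f y)\<^sup>2) x \<partial>\<nu>)"
proof -
  define Y where "Y n \<omega> = f (X (2 * n) \<omega>) + f (X (2 * n + 1) \<omega>)" for n \<omega>
  define Z where "Z n \<omega> = 2 * K f (X n \<omega>)" for n \<omega>
  have Y: "square_integrable M (Y n)" and Z: "square_integrable M (Z n)" if "n \<in> generation q" for n
    unfolding Y_def Z_def using that
    by (auto intro!: square_integrable_add square_integrable_cmult square_integrable_F f K_in_F simp: mem_generation_iff)
  have Y_le: "(\<integral>\<omega>. (Y n \<omega>)\<^sup>2 \<partial>M) \<le> 2 * ((\<integral>\<omega>. (f (X (2 * n) \<omega>))\<^sup>2 \<partial>M) + (\<integral>\<omega>. (f (X (2 * n + 1) \<omega>))\<^sup>2 \<partial>M))"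
    if n: "n \<in> generation q" for n
  proof -
    have int: "integrable M (\<lambda>\<omega>. (f (X (2 * n) \<omega>))\<^sup>2)" "integrable M (\<lambda>\<omega>. (f (X (2 * n + 1) \<omega>))\<^sup>2)"
      using square_integrable_F[OF f, of "2 * n"] square_integrable_F[OF f, of "2 * n + 1"] n
      by (auto simp: square_integrable_def mem_generation_iff)
    have "(\<integral>\<omega>. (Y n \<omega>)\<^sup>2 \<partial>M) \<le> (\<integral>\<omega>. 2 * ((f (X (2 * n) \<omega>))\<^sup>2 + (f (X (2 * n + 1) \<omega>))\<^sup>2) \<partial>M)"
    proof (rule integral_mono)
      have "(a + b)\<^sup>2 \<le> 2 * (a\<^sup>2 + b\<^sup>2)" for a b :: real
        using zero_le_power2[of "a - b"] by (simp add: power2_diff power2_sum)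
      then show "(Y n \<omega>)\<^sup>2 \<le> 2 * ((f (X (2 * n) \<omega>))\<^sup>2 + (f (X (2 * n + 1) \<omega>))\<^sup>2)" for \<omega>
        by (simp only: Y_def)
    qed (use Y[OF n] int in \<open>auto simp: square_integrable_def\<close>)
    then show ?thesis using int by simp
  qed
  have "second_moment (Suc q) f - 4 * second_moment q (K f)
      = (\<integral>\<omega>. (\<Sum>n\<in>generation q. Y n \<omega>)\<^sup>2 \<partial>M) - (\<integral>\<omega>. (\<Sum>n\<in>generation q. Z n \<omega>)\<^sup>2 \<partial>M)"
    by (simp add: second_moment_def sum_generation_Suc Y_def Z_def power_mult_distrib flip: sum_distrib_left)
  also have "\<dots> = (\<Sum>n\<in>generation q. (\<integral>\<omega>. (Y n \<omega>)\<^sup>2 \<partial>M) - (\<integral>\<omega>. (Z n \<omega>)\<^sup>2 \<partial>M))"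
  proof -
    have "(\<integral>\<omega>. Y n \<omega> * Y m \<omega> \<partial>M) = (\<integral>\<omega>. Z n \<omega> * Z m \<omega> \<partial>M)"
      if "n \<in> generation q" "m \<in> generation q - {n}" for n m
      unfolding Y_def Z_def using that by (intro integral_daughters_pair_F f) auto
    then show ?thesis
      by (simp add: integral_square_sum Y Z sum.distrib sum_subtractf)
  qed
  \<comment> \<open>The subtracted second moments of \<open>Z n\<close> are nonnegative and are
    discarded; \<open>Y_le\<close> separates the two daughters.\<close>
  also have "\<dots> \<le> (\<Sum>n\<in>generation q. 2 * ((\<integral>\<omega>. (f (X (2 * n) \<omega>))\<^sup>2 \<partial>M) + (\<integral>\<omega>. (f (X (2 * n + 1) \<omega>))\<^sup>2 \<partial>M)))"
  proof (rule sum_mono)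
    fix n assume "n \<in> generation q"
    then show "(\<integral>\<omega>. (Y n \<omega>)\<^sup>2 \<partial>M) - (\<integral>\<omega>. (Z n \<omega>)\<^sup>2 \<partial>M)
        \<le> 2 * ((\<integral>\<omega>. (f (X (2 * n) \<omega>))\<^sup>2 \<partial>M) + (\<integral>\<omega>. (f (X (2 * n + 1) \<omega>))\<^sup>2 \<partial>M))"
      using Y_le[of n] Bochner_Integration.integral_nonneg[of M "\<lambda>\<omega>. (Z n \<omega>)\<^sup>2"]
      by (smt (verit) zero_le_power2)
  qed
  also have "\<dots> = 2 * (\<Sum>n\<in>generation (Suc q). \<integral>\<omega>. (f (X n \<omega>))\<^sup>2 \<partial>M)"
    by (simp add: sum_generation_Suc sum_distrib_left)
  also have "\<dots> = 4 * 2 ^ q * (\<integral>x. (K ^^ Suc q) (\<lambda>y. (f y)\<^sup>2) x \<partial>\<nu>)"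
    using integral_generation_F[OF F_square[OF f], of "Suc q"] by simp
  finally show ?thesis by simp
qed

text \<open>Iteration of \<open>second_moment_Suc_le\<close> with \<open>f\<close> replaced by
  \<open>K f\<close>. After division by \<open>4 ^ Suc q\<close> the new diagonal term has weight
  \<open>(1/2) ^ q\<close> and becomes the summand \<open>p = q\<close>.\<close>

lemma second_moment_le:
  "f \<in> F \<Longrightarrow> second_moment q f / 4 ^ q \<le> (\<integral>x. ((K ^^ q) f x)\<^sup>2 \<partial>\<nu>)
    + (\<Sum>p<q. (1/2) ^ p * (\<integral>x. (K ^^ Suc p) (\<lambda>y. ((K ^^ (q - 1 - p)) f y)\<^sup>2) x \<partial>\<nu>))"
proof (induction q arbitrary: f)
  case 0
  then show ?case
    using integral_generation_F[OF F_square[OF 0], of 0]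
    by (simp add: second_moment_def generation_0)
next
  case (Suc q)
  define B where "B p g = (\<integral>x. (K ^^ Suc p) (\<lambda>y. (g y)\<^sup>2) x \<partial>\<nu>)" for p g
  have "second_moment (Suc q) f / 4 ^ Suc q \<le> (4 * second_moment q (K f) + 4 * 2 ^ q * B q f) / 4 ^ Suc q"
    unfolding B_def by (intro divide_right_mono second_moment_Suc_le Suc.prems) simp
  also have "\<dots> = second_moment q (K f) / 4 ^ q + (1/2) ^ q * B q f"
  proof -
    have "(4::real) ^ q = 2 ^ q * 2 ^ q" by (simp add: four_power power2_eq_square)
    then show ?thesis by (simp add: field_simps)
  qed
  also have "second_moment q (K f) / 4 ^ q \<le> (\<integral>x. ((K ^^ q) (K f) x)\<^sup>2 \<partial>\<nu>)
      + (\<Sum>p<q. (1/2) ^ p * B p ((K ^^ (q - 1 - p)) (K f)))"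
    unfolding B_def by (intro Suc.IH K_in_F Suc.prems)
  \<comment> \<open>The extra \<open>K\<close> raises the exponent by one; since
    \<open>p < q\<close>, truncated subtraction does no harm.\<close>
  also have "(\<Sum>p<q. (1/2) ^ p * B p ((K ^^ (q - 1 - p)) (K f))) = (\<Sum>p<q. (1/2) ^ p * B p ((K ^^ (Suc q - 1 - p)) f))"
  proof (intro sum.cong refl)
    fix p assume "p \<in> {..<q}"
    then have "Suc q - 1 - p = Suc (q - 1 - p)" by auto
    then show "(1/2) ^ p * B p ((K ^^ (q - 1 - p)) (K f)) = (1/2) ^ p * B p ((K ^^ (Suc q - 1 - p)) f)"
      by (simp add: funpow_Suc_right del: funpow.simps)
  qed
  finally show ?case
    by (simp add: B_def funpow_Suc_right del: funpow.simps)
qed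

lemma second_moment_nonneg: "0 \<le> second_moment q f"
  unfolding second_moment_def by simp

lemma second_moment_tendsto_zero:
  assumes f: "f \<in> F" and mean: "(\<integral>y. f y \<partial>\<mu>) = 0"
  shows "(\<lambda>q. second_moment q f / 4 ^ q) \<longlonglongrightarrow> 0"
proof (rule tendsto_sandwich[OF _ _ tendsto_const \<nu>_K_pow_square_convolution_tendsto_zero[OF f mean]])
  show "\<forall>\<^sub>F q in sequentially. 0 \<le> second_moment q f / 4 ^ q"
    by (simp add: second_moment_nonneg)
qed (intro always_eventually allI second_moment_le[OF f])

section \<open>Initial segments made of complete generations\<close>

lemma square_integrable_sum_F:
  assumes "f \<in> F" "0 \<notin> I"
  shows "square_integrable M (\<lambda>\<omega>. \<Sum>i\<in>I. f (X i \<omega>))"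
proof (intro square_integrable_sum square_integrable_F assms)
  fix i assume "i \<in> I" then show "1 \<le> i" using assms(2) by (cases i) auto
qed

text \<open>Cauchy-Schwarz with weight \<open>2 ^ q\<close> on generation \<open>q\<close> reduces
  the square of the sum to squares of generation sums. Normalising by \<open>4 ^ r\<close> then
  produces a geometric convolution of the normalised second moments.\<close>

lemma integral_initial_segment_le:
  assumes f: "f \<in> F"
  shows "(\<integral>\<omega>. (\<Sum>i\<in>{1..<2 ^ r}. f (X i \<omega>))\<^sup>2 \<partial>M) / 4 ^ r
    \<le> (\<Sum>p<r. (1/2) ^ p * (second_moment (r - 1 - p) f / 4 ^ (r - 1 - p)))"
proof -
  define T where "T q \<omega> = (\<Sum>n\<in>generation q. f (X n \<omega>))" for q \<omega>
  have T: "square_integrable M (T q)" for q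
    unfolding T_def by (intro square_integrable_sum_F f) (simp add: mem_generation_iff)
  have pt: "(\<Sum>i\<in>{1..<2 ^ r}. f (X i \<omega>))\<^sup>2 \<le> 2 ^ r * (\<Sum>q<r. (T q \<omega>)\<^sup>2 / 2 ^ q)" for \<omega>
  proof -
    have "(\<Sum>i\<in>{1..<2 ^ r}. f (X i \<omega>))\<^sup>2 = (\<Sum>q<r. 2 ^ q * (T q \<omega> / 2 ^ q))\<^sup>2"
      by (subst sum_UN_generation) (simp add: T_def)
    also have "\<dots> \<le> (\<Sum>q<r. 2 ^ q) * (\<Sum>q<r. 2 ^ q * (T q \<omega> / 2 ^ q)\<^sup>2)"
      by (rule square_sum_weighted_le) simp
    also have "(\<Sum>q<r. 2 ^ q) = (2 ^ r - 1 :: real)"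
      by (simp add: sum_gp_strict)
    also have "(2 ^ r - 1) * (\<Sum>q<r. 2 ^ q * (T q \<omega> / 2 ^ q)\<^sup>2) \<le> 2 ^ r * (\<Sum>q<r. 2 ^ q * (T q \<omega> / 2 ^ q)\<^sup>2)"
      by (intro mult_right_mono sum_nonneg) auto
    also have "(\<Sum>q<r. 2 ^ q * (T q \<omega> / 2 ^ q)\<^sup>2) = (\<Sum>q<r. (T q \<omega>)\<^sup>2 / 2 ^ q)"
      by (simp add: power2_eq_square)
    finally show ?thesis .
  qed
  have "(\<integral>\<omega>. (\<Sum>i\<in>{1..<2 ^ r}. f (X i \<omega>))\<^sup>2 \<partial>M) \<le> (\<integral>\<omega>. 2 ^ r * (\<Sum>q<r. (T q \<omega>)\<^sup>2 / 2 ^ q) \<partial>M)"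
    using T square_integrable_sum_F[OF f, of "{1..<2 ^ r}"]
    by (intro integral_mono pt) (auto simp: square_integrable_def)
  also have "\<dots> = 2 ^ r * (\<Sum>q<r. second_moment q f / 2 ^ q)"
    using T by (simp add: square_integrable_def second_moment_def T_def)
  finally have "(\<integral>\<omega>. (\<Sum>i\<in>{1..<2 ^ r}. f (X i \<omega>))\<^sup>2 \<partial>M) / 4 ^ r
      \<le> 2 ^ r * (\<Sum>q<r. second_moment q f / 2 ^ q) / 4 ^ r"
    by (intro divide_right_mono) auto
  also have "\<dots> = (\<Sum>q<r. second_moment q f / 2 ^ q / 2 ^ r)"
  proof -
    have "(4::real) ^ r = 2 ^ r * 2 ^ r" by (simp add: four_power power2_eq_square)
    then show ?thesis by (simp add: sum_divide_distrib)
  qed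
  also have "\<dots> \<le> (\<Sum>q<r. (1/2) ^ (r - Suc q) * (second_moment q f / 4 ^ q))"
  proof (rule sum_mono)
    \<comment> \<open>The exact weight is half of \<open>(1/2) ^ (r - Suc q)\<close>; the spare
      factor is given away to match the shape of the convolution.\<close>
    fix q assume "q \<in> {..<r}"
    then have "r = Suc (r - Suc q) + q" by auto
    then have "(2::real) ^ r = 2 * 2 ^ (r - Suc q) * 2 ^ q"
      by (metis power_Suc power_add)
    moreover have "(4::real) ^ q = 2 ^ q * 2 ^ q" by (simp add: four_power power2_eq_square)
    ultimately have "second_moment q f / 2 ^ q / 2 ^ r = (1/2) * ((1/2) ^ (r - Suc q) * (second_moment q f / 4 ^ q))"
      by (simp add: power_one_over divide_simps)
    moreover have "0 \<le> (1/2) ^ (r - Suc q) * (second_moment q f / 4 ^ q)"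
      using second_moment_nonneg[of q f] by simp
    ultimately show "second_moment q f / 2 ^ q / 2 ^ r \<le> (1/2) ^ (r - Suc q) * (second_moment q f / 4 ^ q)"
      by linarith
  qed
  also have "\<dots> = (\<Sum>p<r. (1/2) ^ p * (second_moment (r - 1 - p) f / 4 ^ (r - 1 - p)))"
    by (subst sum.nat_diff_reindex[symmetric]) (intro sum.cong refl, simp)
  finally show ?thesis .
qed

lemma integral_initial_segment_tendsto_zero:
  assumes f: "f \<in> F" and mean: "(\<integral>y. f y \<partial>\<mu>) = 0"
  shows "(\<lambda>r. (\<integral>\<omega>. (\<Sum>i\<in>{1..<2 ^ r}. f (X i \<omega>))\<^sup>2 \<partial>M) / 4 ^ r) \<longlonglongrightarrow> 0"
proof -
  note lim = second_moment_tendsto_zero[OF f mean]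
  obtain C where "\<And>q. \<bar>second_moment q f / 4 ^ q\<bar> \<le> C"
    using convergent_imp_Bseq[OF convergentI[OF lim]] unfolding Bseq_def real_norm_def by blast
  \<comment> \<open>Here the array is constant in \<open>p\<close>, and the uniform bound comes from
    convergence of the normalised second moments.\<close>
  note conv = tendsto_geometric_convolution_zero[of "\<lambda>_ q. second_moment q f / 4 ^ q", OF this lim]
  show ?thesis
  proof (rule tendsto_sandwich[OF _ _ tendsto_const conv])
    show "\<forall>\<^sub>F r in sequentially. 0 \<le> (\<integral>\<omega>. (\<Sum>i\<in>{1..<2 ^ r}. f (X i \<omega>))\<^sup>2 \<partial>M) / 4 ^ r" by simp
  qed (intro always_eventually allI integral_initial_segment_le f)
qed

section \<open>Averages along the random permutation\<close>

context
  fixes Perm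
  assumes unif: "uniform_generation_permutation M Perm" and indep: "perm_indep_process M Perm X"
begin

lemma Perm_image_generation: "\<omega> \<in> space M \<Longrightarrow> Perm \<omega> ` generation q = generation q"
  and Perm_inj: "\<omega> \<in> space M \<Longrightarrow> inj_on (Perm \<omega>) {1..}"
  using unif by (auto simp: uniform_generation_permutation_def bij_betw_def)

lemma restrict_Perm_measurable:
  "(\<lambda>\<omega>. restrict_id (Perm \<omega>) (generation q)) \<in> M \<rightarrow>\<^sub>M count_space {\<sigma>. \<sigma> permutes generation q}"
  using unif by (auto simp: uniform_generation_permutation_def indep_vars_def)

text \<open>For \<open>\<sigma>\<close> ranging over the permutations of generation
  \<open>q\<close>, these events partition the probability space; on each of them the random
  permutation may be replaced by a fixed one.\<close>

definition perm_event :: "nat \<Rightarrow> (nat \<Rightarrow> nat) \<Rightarrow> 'w set" where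
  "perm_event q \<sigma> = {\<omega> \<in> space M. restrict_id (Perm \<omega>) (generation q) = \<sigma>}"

text \<open>Finitely many coordinates of \<open>Perm\<close> describe the event, which places it in
  the \<open>\<sigma>\<close>-field generated by the permutation.\<close>

lemma perm_event_eq:
  assumes "\<sigma> permutes generation q"
  shows "perm_event q \<sigma> = {\<omega> \<in> space M. \<forall>i\<in>generation q. Perm \<omega> i = \<sigma> i}"
  using assms by (auto simp: perm_event_def fun_eq_iff restrict_id_def permutes_def)

lemma prob_perm_event:
  assumes \<sigma>: "\<sigma> permutes generation q"
  shows "prob (perm_event q \<sigma>) = 1 / fact (2 ^ q)"
proof -
  let ?S = "{\<sigma>. \<sigma> permutes generation q}"
  have "prob (perm_event q \<sigma>) = measure (distr M (count_space ?S) (\<lambda>\<omega>. restrict_id (Perm \<omega>) (generation q))) {\<sigma>}"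
    using \<sigma> by (subst measure_distr[OF restrict_Perm_measurable])
      (auto simp: perm_event_def vimage_def Int_def conj_commute intro!: arg_cong[where f = prob])
  also have "\<dots> = measure (uniform_count_measure ?S) {\<sigma>}"
    using unif by (simp add: uniform_generation_permutation_def)
  also have "\<dots> = 1 / fact (2 ^ q)"
    using \<sigma> by (simp add: measure_uniform_count_measure finite_permutations card_permutations[OF card_generation])
  finally show ?thesis .
qed

lemma perm_event_sets [measurable]:
  assumes "\<sigma> permutes generation q"
  shows "perm_event q \<sigma> \<in> sets M"
proof -
  have "perm_event q \<sigma> = (\<lambda>\<omega>. restrict_id (Perm \<omega>) (generation q)) -` {\<sigma>} \<inter> space M"
    by (auto simp: perm_event_def)
  then show ?thesis
    using measurable_sets[OF restrict_Perm_measurable, of "{\<sigma>}" q] assms by simp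
qed

text \<open>Once \<open>\<sigma>\<close> is fixed, the indicator depends on the permutation alone
  and the square on the chain alone, so independence factorises the integral.\<close>

lemma integral_perm_event:
  assumes f: "f \<in> F" and I: "I \<subseteq> generation q" and \<sigma>: "\<sigma> permutes generation q"
  shows "(\<integral>\<omega>. indicator (perm_event q \<sigma>) \<omega> * (\<Sum>i\<in>I. f (X (\<sigma> i) \<omega>))\<^sup>2 \<partial>M)
    = (\<integral>\<omega>. (\<Sum>i\<in>I. f (X (\<sigma> i) \<omega>))\<^sup>2 \<partial>M) / fact (2 ^ q)"
proof -
  have ge1: "1 \<le> \<sigma> i" if "i \<in> I" for i
  proof -
    have "\<sigma> i \<in> generation q" using permutes_in_image[OF \<sigma>] I that by blast
    then show ?thesis by (simp add: mem_generation_iff)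
  qed
  define VP where "VP = vimage_algebra (space M) (\<lambda>\<omega>. \<lambda>n\<in>{1..}. Perm \<omega> n) (\<Pi>\<^sub>M n\<in>{1..}. count_space UNIV)"
  define VX where "VX = vimage_algebra (space M) (\<lambda>\<omega>. \<lambda>n\<in>{1..}. X n \<omega>) (\<Pi>\<^sub>M n\<in>{1..}. (borel :: 's measure))"
  have sp: "space VP = space M" "space VX = space M" by (auto simp: VP_def VX_def)
  have Perm_VP: "(\<lambda>\<omega>. Perm \<omega> i) \<in> VP \<rightarrow>\<^sub>M count_space UNIV" if "i \<ge> 1" for i
  proof -
    have "(\<lambda>\<omega>. \<lambda>n\<in>{1..}. Perm \<omega> n) \<in> VP \<rightarrow>\<^sub>M (\<Pi>\<^sub>M n\<in>{1..}. count_space UNIV)"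
      unfolding VP_def by (rule measurable_vimage_algebra1) (auto simp: space_PiM)
    from measurable_compose[OF this measurable_component_singleton[of i]] that show ?thesis by simp
  qed
  have X_VX: "X i \<in> VX \<rightarrow>\<^sub>M borel" if "i \<ge> 1" for i
  proof -
    have "(\<lambda>\<omega>. \<lambda>n\<in>{1..}. X n \<omega>) \<in> VX \<rightarrow>\<^sub>M (\<Pi>\<^sub>M n\<in>{1..}. borel)"
      unfolding VX_def by (rule measurable_vimage_algebra1) (auto simp: space_PiM)
    from measurable_compose[OF this measurable_component_singleton[of i]] that show ?thesis by simp
  qed
  have "{\<omega> \<in> space VP. \<forall>i\<in>generation q. Perm \<omega> i = \<sigma> i} \<in> sets VP"
  proof (rule sets.sets_Collect_finite_All')
    fix i assume "i \<in> generation q"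
    then have "(\<lambda>\<omega>. Perm \<omega> i) -` {\<sigma> i} \<inter> space VP \<in> sets VP"
      by (intro measurable_sets[OF Perm_VP]) (auto simp: mem_generation_iff)
    then show "{\<omega> \<in> space VP. Perm \<omega> i = \<sigma> i} \<in> sets VP"
      by (simp add: vimage_def Int_def conj_commute)
  qed (auto simp: generation_def)
  then have "indicator (perm_event q \<sigma>) \<in> borel_measurable VP"
    by (simp add: perm_event_eq[OF \<sigma>] sp)
  moreover have "(\<lambda>\<omega>. (\<Sum>i\<in>I. f (X (\<sigma> i) \<omega>))\<^sup>2) \<in> borel_measurable VX"
    by (intro borel_measurable_power borel_measurable_sum measurable_compose[OF X_VX F_measurable[OF f]] ge1)
  moreover have "indep_set (sets VP) (sets VX)"
    using indep by (simp add: perm_indep_process_def VP_def VX_def)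
  ultimately have iv: "indep_var borel (indicator (perm_event q \<sigma>)) borel (\<lambda>\<omega>. (\<Sum>i\<in>I. f (X (\<sigma> i) \<omega>))\<^sup>2)"
    using sp by (intro indep_var_of_indep_set[of VP VX]) auto
  show ?thesis
  proof -
    have "square_integrable M (\<lambda>\<omega>. \<Sum>i\<in>I. f (X (\<sigma> i) \<omega>))"
      by (intro square_integrable_sum square_integrable_F f ge1)
    with indep_var_lebesgue_integral[OF iv] show ?thesis
      by (simp add: square_integrable_def perm_event_sets[OF \<sigma>] prob_perm_event[OF \<sigma>] less_top[symmetric])
  qed
qed

text \<open>Splitting along the events \<open>perm_event q \<sigma>\<close> makes the second moment
  an average over deterministic permutations. For each fixed \<open>\<omega>\<close>,
  \<open>sum_permutes_square_le\<close> then applies to the values of the chain on the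
  generation.\<close>

lemma
  assumes f: "f \<in> F" and I: "I \<subseteq> generation q"
  shows square_integrable_perm_sum: "square_integrable M (\<lambda>\<omega>. \<Sum>i\<in>I. f (X (Perm \<omega> i) \<omega>))"
    and integral_perm_sum_le: "(\<integral>\<omega>. (\<Sum>i\<in>I. f (X (Perm \<omega> i) \<omega>))\<^sup>2 \<partial>M)
      \<le> (card I / 2 ^ q) * (\<Sum>n\<in>generation q. \<integral>\<omega>. (f (X n \<omega>))\<^sup>2 \<partial>M)
        + (card I / 2 ^ q)\<^sup>2 * second_moment q f"
proof -
  let ?S = "{\<sigma>. \<sigma> permutes generation q}"
  have finS: "finite ?S" by (simp add: finite_permutations)
  define D where "D \<sigma> \<omega> = (\<Sum>i\<in>I. f (X (\<sigma> i) \<omega>))" for \<sigma> \<omega>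
  have D: "square_integrable M (D \<sigma>)" if "\<sigma> \<in> ?S" for \<sigma>
  proof -
    have "1 \<le> \<sigma> i" if "i \<in> I" for i
    proof -
      have "\<sigma> i \<in> generation q" using permutes_in_image[of \<sigma> "generation q"] I that \<open>\<sigma> \<in> ?S\<close> by blast
      then show ?thesis by (simp add: mem_generation_iff)
    qed
    then show ?thesis
      unfolding D_def by (intro square_integrable_sum square_integrable_F f)
  qed
  \<comment> \<open>The function \<open>h\<close> stays arbitrary because the decomposition is used
    twice: with the identity for square integrability and with the square for the second
    moment.\<close>
  have decomp: "h (\<Sum>i\<in>I. f (X (Perm \<omega> i) \<omega>)) = (\<Sum>\<sigma>\<in>?S. indicator (perm_event q \<sigma>) \<omega> * h (D \<sigma> \<omega>))"
    if \<omega>: "\<omega> \<in> space M" for h :: "real \<Rightarrow> real" and \<omega>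
  proof -
    define \<rho> where "\<rho> = restrict_id (Perm \<omega>) (generation q)"
    have \<rho>: "\<rho> \<in> ?S" using measurable_space[OF restrict_Perm_measurable \<omega>] by (simp add: \<rho>_def)
    have "(\<Sum>\<sigma>\<in>?S. indicator (perm_event q \<sigma>) \<omega> * h (D \<sigma> \<omega>)) = (\<Sum>\<sigma>\<in>?S. if \<sigma> = \<rho> then h (D \<rho> \<omega>) else 0)"
      using \<omega> by (intro sum.cong) (auto simp: perm_event_def \<rho>_def)
    also have "\<dots> = h (D \<rho> \<omega>)" using \<rho> finS by simp
    also have "D \<rho> \<omega> = (\<Sum>i\<in>I. f (X (Perm \<omega> i) \<omega>))"
      unfolding D_def \<rho>_def using I by (intro sum.cong) auto
    finally show ?thesis by simp
  qed
  have ind: "integrable M (\<lambda>\<omega>. indicator (perm_event q \<sigma>) \<omega> * (D \<sigma> \<omega>)\<^sup>2)" if "\<sigma> \<in> ?S" for \<sigma>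
    using D[OF that] that integrable_mult_indicator[of "perm_event q \<sigma>" M "\<lambda>\<omega>. (D \<sigma> \<omega>)\<^sup>2"]
    by (simp add: square_integrable_def perm_event_sets)
  have sq: "square_integrable M (\<lambda>\<omega>. \<Sum>\<sigma>\<in>?S. indicator (perm_event q \<sigma>) \<omega> * D \<sigma> \<omega>)"
  proof (rule square_integrable_sum)
    fix \<sigma> assume \<sigma>: "\<sigma> \<in> ?S"
    have "(indicator (perm_event q \<sigma>) \<omega> * D \<sigma> \<omega>)\<^sup>2 = indicator (perm_event q \<sigma>) \<omega> * (D \<sigma> \<omega>)\<^sup>2" for \<omega>
      by (auto simp: indicator_def)
    then show "square_integrable M (\<lambda>\<omega>. indicator (perm_event q \<sigma>) \<omega> * D \<sigma> \<omega>)"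
      using D[OF \<sigma>] ind[OF \<sigma>] perm_event_sets[of \<sigma> q] \<sigma> by (auto simp: square_integrable_def)
  qed
  then show "square_integrable M (\<lambda>\<omega>. \<Sum>i\<in>I. f (X (Perm \<omega> i) \<omega>))"
    unfolding square_integrable_def using decomp[of _ "\<lambda>x. x"]
    by (simp cong: measurable_cong Bochner_Integration.integrable_cong)
  have "(\<integral>\<omega>. (\<Sum>i\<in>I. f (X (Perm \<omega> i) \<omega>))\<^sup>2 \<partial>M)
      = (\<integral>\<omega>. (\<Sum>\<sigma>\<in>?S. indicator (perm_event q \<sigma>) \<omega> * (D \<sigma> \<omega>)\<^sup>2) \<partial>M)"
    by (intro Bochner_Integration.integral_cong refl decomp)
  also have "\<dots> = (\<Sum>\<sigma>\<in>?S. (\<integral>\<omega>. (D \<sigma> \<omega>)\<^sup>2 \<partial>M) / fact (2 ^ q))"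
    using integral_perm_event[OF f I] ind by (simp add: D_def)
  also have "\<dots> = (\<integral>\<omega>. (\<Sum>\<sigma>\<in>?S. (D \<sigma> \<omega>)\<^sup>2) / fact (2 ^ q) \<partial>M)"
    using D by (simp add: square_integrable_def sum_divide_distrib)
  also have "\<dots> \<le> (\<integral>\<omega>. (card I / 2 ^ q) * (\<Sum>n\<in>generation q. (f (X n \<omega>))\<^sup>2)
      + (card I / 2 ^ q)\<^sup>2 * (\<Sum>n\<in>generation q. f (X n \<omega>))\<^sup>2 \<partial>M)"
  proof (rule integral_mono)
    show "integrable M (\<lambda>\<omega>. (\<Sum>\<sigma>\<in>?S. (D \<sigma> \<omega>)\<^sup>2) / fact (2 ^ q))"
      using D by (intro integrable_divide Bochner_Integration.integrable_sum) (auto simp: square_integrable_def)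
    have "integrable M (\<lambda>\<omega>. (\<Sum>n\<in>generation q. f (X n \<omega>))\<^sup>2)"
      using square_integrable_sum_F[OF f, of "generation q"] by (simp add: square_integrable_def mem_generation_iff)
    moreover have "integrable M (\<lambda>\<omega>. \<Sum>n\<in>generation q. (f (X n \<omega>))\<^sup>2)"
      using square_integrable_F[OF f]
      by (intro Bochner_Integration.integrable_sum) (simp add: square_integrable_def mem_generation_iff)
    ultimately show "integrable M (\<lambda>\<omega>. (card I / 2 ^ q) * (\<Sum>n\<in>generation q. (f (X n \<omega>))\<^sup>2)
      + (card I / 2 ^ q)\<^sup>2 * (\<Sum>n\<in>generation q. f (X n \<omega>))\<^sup>2)" by simp
    show "(\<Sum>\<sigma>\<in>?S. (D \<sigma> \<omega>)\<^sup>2) / fact (2 ^ q) \<le> (card I / 2 ^ q) * (\<Sum>n\<in>generation q. (f (X n \<omega>))\<^sup>2)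
      + (card I / 2 ^ q)\<^sup>2 * (\<Sum>n\<in>generation q. f (X n \<omega>))\<^sup>2" for \<omega>
      using sum_permutes_square_le[OF finite_generation I, of "\<lambda>j. f (X j \<omega>)"] by (simp add: D_def)
  qed
  also have "\<dots> = (card I / 2 ^ q) * (\<Sum>n\<in>generation q. \<integral>\<omega>. (f (X n \<omega>))\<^sup>2 \<partial>M)
        + (card I / 2 ^ q)\<^sup>2 * second_moment q f"
  proof -
    have "integrable M (\<lambda>\<omega>. (\<Sum>n\<in>generation q. f (X n \<omega>))\<^sup>2)"
      using square_integrable_sum_F[OF f, of "generation q"] by (simp add: square_integrable_def mem_generation_iff)
    moreover have "integrable M (\<lambda>\<omega>. (f (X n \<omega>))\<^sup>2)" if "n \<in> generation q" for n
      using square_integrable_F[OF f] that by (simp add: square_integrable_def mem_generation_iff)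
    ultimately show ?thesis by (simp add: second_moment_def)
  qed
  finally show "(\<integral>\<omega>. (\<Sum>i\<in>I. f (X (Perm \<omega> i) \<omega>))\<^sup>2 \<partial>M)
      \<le> (card I / 2 ^ q) * (\<Sum>n\<in>generation q. \<integral>\<omega>. (f (X n \<omega>))\<^sup>2 \<partial>M)
        + (card I / 2 ^ q)\<^sup>2 * second_moment q f" .
qed

section \<open>Splitting the permuted average at the last generation\<close>

lemma sum_Perm_initial_segment:
  assumes \<omega>: "\<omega> \<in> space M"
  shows "(\<Sum>i\<in>{1..<2 ^ r}. h (Perm \<omega> i)) = (\<Sum>i\<in>{1..<2 ^ r}. h i)"
proof -
  have "Perm \<omega> ` {1..<2 ^ r} = {1..<2 ^ r}"
    unfolding UN_generation[symmetric] image_UN by (simp add: Perm_image_generation[OF \<omega>])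
  moreover have "inj_on (Perm \<omega>) {1..<2 ^ r}"
    using Perm_inj[OF \<omega>] by (rule inj_on_subset) auto
  ultimately show ?thesis
    using sum.reindex[of "Perm \<omega>" "{1..<2 ^ r}" h] by (simp add: o_def)
qed

lemma perm_avg_eq:
  assumes "\<omega> \<in> space M" "n \<ge> 1"
  shows "perm_avg X Perm n f \<omega>
    = ((\<Sum>i\<in>{1..<2 ^ gen_of n}. f (X i \<omega>)) + (\<Sum>i\<in>{2 ^ gen_of n..n}. f (X (Perm \<omega> i) \<omega>))) / n"
proof -
  have "(2::nat) ^ gen_of n \<le> n" "1 \<le> (2::nat) ^ gen_of n"
    using assms(2) mem_generation_iff[of n "gen_of n"] by (auto simp: generation_def)
  then have "{1..n} = {1..<2 ^ gen_of n} \<union> {2 ^ gen_of n..n}"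
    by (intro ivl_disj_un_two(7)[symmetric])
  moreover have "{1..<2 ^ gen_of n} \<inter> {2 ^ gen_of n..n} = {}" by auto
  ultimately show ?thesis
    using sum_Perm_initial_segment[OF assms(1), of "\<lambda>i. f (X i \<omega>)" "gen_of n"]
    by (simp add: perm_avg_def sum.union_disjoint)
qed

lemma last_generation_subset: "n \<ge> 1 \<Longrightarrow> {2 ^ gen_of n..n} \<subseteq> generation (gen_of n)"
proof -
  assume "n \<ge> 1"
  then have "n \<in> generation (gen_of n)" by (simp add: mem_generation_iff)
  then show ?thesis unfolding generation_def by auto
qed

lemma square_integrable_perm_avg:
  assumes f: "f \<in> F"
  shows "square_integrable M (perm_avg X Perm n f)"
proof (cases "n = 0")
  \<comment> \<open>At \<open>n = 0\<close> the average is the constant 0, from an empty sum and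
    division by zero.\<close>
  case True
  then show ?thesis by (simp add: perm_avg_def[abs_def] square_integrable_def)
next
  case False
  let ?g = "\<lambda>\<omega>. (1 / n) * ((\<Sum>i\<in>{1..<2 ^ gen_of n}. f (X i \<omega>)) + (\<Sum>i\<in>{2 ^ gen_of n..n}. f (X (Perm \<omega> i) \<omega>)))"
  have "square_integrable M ?g"
    using False by (intro square_integrable_cmult square_integrable_add square_integrable_sum_F
        square_integrable_perm_sum[OF f last_generation_subset] f) auto
  moreover have "perm_avg X Perm n f \<omega> = ?g \<omega>" if "\<omega> \<in> space M" for \<omega>
    using perm_avg_eq[OF that, of n f] False by simp
  ultimately show ?thesis
    unfolding square_integrable_def
    by (simp cong: measurable_cong Bochner_Integration.integrable_cong)
qed

text \<open>The complete generations give an unpermuted initial segment, and the rest is a uniform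
  sample from the last generation. The sample costs a diagonal term \<open>H / n\<close> and at most
  the normalised second moment of that generation.\<close>

lemma perm_avg_second_moment_tendsto_zero:
  assumes f: "f \<in> F" and mean: "(\<integral>y. f y \<partial>\<mu>) = 0"
  shows "(\<lambda>n. \<integral>\<omega>. (perm_avg X Perm n f \<omega>)\<^sup>2 \<partial>M) \<longlonglongrightarrow> 0"
proof -
  obtain h where h: "h \<in> F" "\<And>r x. \<bar>(K ^^ r) (\<lambda>y. (f y)\<^sup>2) x\<bar> \<le> h x"
    using K_pow_bounded[OF F_square[OF f]] by blast
  \<comment> \<open>Since \<open>h\<close> dominates every iterate of the square of
    \<open>f\<close>, \<open>2 ^ q * H\<close> bounds the sum of the second moments over the
    vertices of generation \<open>q\<close>, uniformly in the normalised sense.\<close>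
  define H where "H = (\<integral>x. h x \<partial>\<nu>)"
  have H: "(\<Sum>n\<in>generation q. \<integral>\<omega>. (f (X n \<omega>))\<^sup>2 \<partial>M) \<le> 2 ^ q * H" for q
  proof -
    have "(\<integral>x. (K ^^ q) (\<lambda>y. (f y)\<^sup>2) x \<partial>\<nu>) \<le> H"
      unfolding H_def using h(2)[of q]
      by (intro integral_mono F_integrable_\<nu> K_pow_in_F F_square f h) (simp add: abs_le_iff)
    then show ?thesis
      using integral_generation_F[OF F_square[OF f], of q] by simp
  qed
  define b where "b r = (\<integral>\<omega>. (\<Sum>i\<in>{1..<2 ^ r}. f (X i \<omega>))\<^sup>2 \<partial>M) / 4 ^ r" for r
  have H0: "0 \<le> H"
    using H[of 0] sum_nonneg[of "generation 0" "\<lambda>n. \<integral>\<omega>. (f (X n \<omega>))\<^sup>2 \<partial>M"] by simp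
  have bound: "(\<integral>\<omega>. (perm_avg X Perm n f \<omega>)\<^sup>2 \<partial>M)
      \<le> 2 * b (gen_of n) + 2 * (H / n + second_moment (gen_of n) f / 4 ^ gen_of n)" if n: "n \<ge> 1" for n
  proof -
    define r where "r = gen_of n"
    define U where "U \<omega> = (\<Sum>i\<in>{1..<2 ^ r}. f (X i \<omega>))" for \<omega>
    define R where "R \<omega> = (\<Sum>i\<in>{2 ^ r..n}. f (X (Perm \<omega> i) \<omega>))" for \<omega>
    define k where "k = card {2 ^ r..n}"
    have "n \<in> generation r" using n by (simp add: r_def mem_generation_iff)
    then have rn: "2 ^ r \<le> n" and nr: "n < 2 ^ Suc r" by (auto simp: generation_def)
    have kn: "k \<le> n"
      using card_mono[of "{1..n}" "{2 ^ r..n}"] by (simp add: k_def)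
    have rn': "(2::real) ^ r \<le> n" using rn by (metis of_nat_le_iff of_nat_numeral of_nat_power)
    have U: "square_integrable M U" unfolding U_def by (rule square_integrable_sum_F[OF f]) simp
    have R: "square_integrable M R"
      unfolding R_def r_def by (rule square_integrable_perm_sum[OF f last_generation_subset[OF n]])
    have "(\<integral>\<omega>. (R \<omega>)\<^sup>2 \<partial>M) \<le> (k / 2 ^ r) * (\<Sum>n\<in>generation r. \<integral>\<omega>. (f (X n \<omega>))\<^sup>2 \<partial>M)
        + (k / 2 ^ r)\<^sup>2 * second_moment r f"
      unfolding R_def k_def r_def by (rule integral_perm_sum_le[OF f last_generation_subset[OF n]])
    also have "\<dots> \<le> (k / 2 ^ r) * (2 ^ r * H) + (k / 2 ^ r)\<^sup>2 * second_moment r f"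
      by (intro add_right_mono mult_left_mono H) simp
    also have "\<dots> = k * H + (real k)\<^sup>2 * (second_moment r f / 4 ^ r)"
      by (simp add: power_divide four_power)
    also have "\<dots> \<le> n * H + (real n)\<^sup>2 * (second_moment r f / 4 ^ r)"
      using kn H0 second_moment_nonneg[of r f] by (intro add_mono mult_right_mono power_mono) auto
    finally have "(\<integral>\<omega>. (R \<omega>)\<^sup>2 \<partial>M) / (real n)\<^sup>2 \<le> (n * H + (real n)\<^sup>2 * (second_moment r f / 4 ^ r)) / (real n)\<^sup>2"
      by (rule divide_right_mono) simp
    also have "\<dots> = H / n + second_moment r f / 4 ^ r"
      using n by (simp add: add_divide_distrib power2_eq_square)
    finally have R_le: "(\<integral>\<omega>. (R \<omega>)\<^sup>2 \<partial>M) / (real n)\<^sup>2 \<le> H / n + second_moment r f / 4 ^ r" .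
    \<comment> \<open>The inequality \<open>2 ^ r \<le> n\<close> replaces the size of the sample by
      the normalisation of the complete generations.\<close>
    have "(\<integral>\<omega>. (U \<omega>)\<^sup>2 \<partial>M) / (real n)\<^sup>2 \<le> (\<integral>\<omega>. (U \<omega>)\<^sup>2 \<partial>M) / (2 ^ r)\<^sup>2"
      using rn' n by (intro divide_left_mono power_mono) auto
    also have "\<dots> = b r" by (simp add: b_def U_def four_power)
    finally have U_le: "(\<integral>\<omega>. (U \<omega>)\<^sup>2 \<partial>M) / (real n)\<^sup>2 \<le> b r" .
    have "(\<integral>\<omega>. (perm_avg X Perm n f \<omega>)\<^sup>2 \<partial>M) \<le> (\<integral>\<omega>. 2 * ((U \<omega>)\<^sup>2 / (real n)\<^sup>2) + 2 * ((R \<omega>)\<^sup>2 / (real n)\<^sup>2) \<partial>M)"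
    proof (rule integral_mono)
      fix \<omega> assume \<omega>: "\<omega> \<in> space M"
      have "(a + b)\<^sup>2 \<le> 2 * a\<^sup>2 + 2 * b\<^sup>2" for a b :: real
        using zero_le_power2[of "a - b"] by (simp add: power2_diff power2_sum)
      from this[of "U \<omega> / n" "R \<omega> / n"] show "(perm_avg X Perm n f \<omega>)\<^sup>2 \<le> 2 * ((U \<omega>)\<^sup>2 / (real n)\<^sup>2) + 2 * ((R \<omega>)\<^sup>2 / (real n)\<^sup>2)"
        unfolding perm_avg_eq[OF \<omega> n] by (simp add: U_def R_def r_def power_divide add_divide_distrib)
    qed (use U R square_integrable_perm_avg[OF f, of n] in \<open>auto simp: square_integrable_def\<close>)
    also have "\<dots> = 2 * ((\<integral>\<omega>. (U \<omega>)\<^sup>2 \<partial>M) / (real n)\<^sup>2) + 2 * ((\<integral>\<omega>. (R \<omega>)\<^sup>2 \<partial>M) / (real n)\<^sup>2)"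
      using U R by (simp add: square_integrable_def)
    finally show ?thesis using U_le R_le by (simp add: r_def)
  qed
  have "(\<lambda>n. 2 * b (gen_of n) + 2 * (H / n + second_moment (gen_of n) f / 4 ^ gen_of n)) \<longlonglongrightarrow> 2 * 0 + 2 * (0 + 0)"
    unfolding b_def
    by (intro tendsto_add tendsto_mult tendsto_const lim_const_over_n
        filterlim_compose[OF integral_initial_segment_tendsto_zero[OF f mean] filterlim_gen_of]
        filterlim_compose[OF second_moment_tendsto_zero[OF f mean] filterlim_gen_of])
  then have lim: "(\<lambda>n. 2 * b (gen_of n) + 2 * (H / n + second_moment (gen_of n) f / 4 ^ gen_of n)) \<longlonglongrightarrow> 0" by simp
  show ?thesis
  proof (rule tendsto_sandwich[OF _ _ tendsto_const lim])
    show "\<forall>\<^sub>F n in sequentially. 0 \<le> (\<integral>\<omega>. (perm_avg X Perm n f \<omega>)\<^sup>2 \<partial>M)" by simp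
    show "\<forall>\<^sub>F n in sequentially. (\<integral>\<omega>. (perm_avg X Perm n f \<omega>)\<^sup>2 \<partial>M)
        \<le> 2 * b (gen_of n) + 2 * (H / n + second_moment (gen_of n) f / 4 ^ gen_of n)"
      using eventually_ge_at_top[of 1] by eventually_elim (rule bound)
  qed
qed

end

section \<open>The averages over a generation and over the tree\<close>

lemma square_integrable_avg:
  "f \<in> F \<Longrightarrow> 0 \<notin> I \<Longrightarrow> square_integrable M (avg X I f)"
  using square_integrable_cmult[OF square_integrable_sum_F[of f I], of "1 / card I"]
  by (simp add: avg_def[abs_def])

lemma avg_generation_second_moment_tendsto_zero:
  assumes f: "f \<in> F" and mean: "(\<integral>y. f y \<partial>\<mu>) = 0"
  shows "(\<lambda>q. \<integral>\<omega>. (avg X (generation q) f \<omega>)\<^sup>2 \<partial>M) \<longlonglongrightarrow> 0"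
proof -
  have "(\<integral>\<omega>. (avg X (generation q) f \<omega>)\<^sup>2 \<partial>M) = second_moment q f / 4 ^ q" for q
    by (simp add: avg_def second_moment_def power_divide four_power)
  then show ?thesis using second_moment_tendsto_zero[OF f mean] by simp
qed

text \<open>The tree up to \<open>r\<close> has \<open>2 * 2 ^ r - 1 \<ge> 2 ^ r\<close> vertices,
  so normalising by its size instead of \<open>2 ^ Suc r\<close> costs at most a factor 4 in mean
  square.\<close>

lemma avg_tree_second_moment_tendsto_zero:
  assumes f: "f \<in> F" and mean: "(\<integral>y. f y \<partial>\<mu>) = 0"
  shows "(\<lambda>r. \<integral>\<omega>. (avg X (tree_upto r) f \<omega>)\<^sup>2 \<partial>M) \<longlonglongrightarrow> 0"
proof -
  define b where "b r = (\<integral>\<omega>. (\<Sum>i\<in>{1..<2 ^ r}. f (X i \<omega>))\<^sup>2 \<partial>M) / 4 ^ r" for r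
  have bound: "(\<integral>\<omega>. (avg X (tree_upto r) f \<omega>)\<^sup>2 \<partial>M) \<le> 4 * b (Suc r)" for r
  proof -
    define J where "J = (\<integral>\<omega>. (\<Sum>i\<in>{1..<2 ^ Suc r}. f (X i \<omega>))\<^sup>2 \<partial>M)"
    have c: "real (card (tree_upto r)) = 2 * 2 ^ r - 1"
      by (simp add: tree_upto_eq of_nat_diff)
    have "(\<integral>\<omega>. (avg X (tree_upto r) f \<omega>)\<^sup>2 \<partial>M) = J / (2 * 2 ^ r - 1)\<^sup>2"
      unfolding avg_def c by (simp add: J_def tree_upto_eq power_divide)
    also have "\<dots> \<le> J / (2 ^ r)\<^sup>2"
    proof (intro divide_left_mono power_mono)
      have "1 \<le> (2::real) ^ r" by simp
      then have "2 * 2 ^ r - 1 \<noteq> (0::real)" by linarith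
      then show "0 < (2 * 2 ^ r - 1 :: real)\<^sup>2 * (2 ^ r)\<^sup>2" by simp
      show "(2::real) ^ r \<le> 2 * 2 ^ r - 1" using \<open>1 \<le> 2 ^ r\<close> by linarith
    qed (auto simp: J_def)
    also have "\<dots> = 4 * b (Suc r)"
      by (simp add: J_def b_def four_power)
    finally show ?thesis .
  qed
  have "(\<lambda>r. 4 * b (Suc r)) \<longlonglongrightarrow> 4 * 0"
    unfolding b_def by (intro tendsto_mult tendsto_const LIMSEQ_Suc[OF integral_initial_segment_tendsto_zero[OF f mean]])
  then have lim: "(\<lambda>r. 4 * b (Suc r)) \<longlonglongrightarrow> 0" by simp
  show ?thesis
  proof (rule tendsto_sandwich[OF _ _ tendsto_const lim])
    show "\<forall>\<^sub>F r in sequentially. 0 \<le> (\<integral>\<omega>. (avg X (tree_upto r) f \<omega>)\<^sup>2 \<partial>M)" by simp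
  qed (intro always_eventually allI bound)
qed

end

theorem theorem11:
  fixes M :: "'w measure"
    and Fil :: "nat \<Rightarrow> 'w measure"
    and X :: "nat \<Rightarrow> 'w \<Rightarrow> 's::metric_space"
    and \<nu> \<mu> :: "'s measure"
    and P :: "'s \<Rightarrow> ('s \<times> 's) measure"
    and Perm :: "'w \<Rightarrow> nat \<Rightarrow> nat"
    and F :: "('s \<Rightarrow> real) set"
    and f :: "'s \<Rightarrow> real"
  assumes "bifurcating_markov_chain M Fil X \<nu> P"
    and "uniform_generation_permutation M Perm"
    and "perm_indep_process M Perm X"
    and "admissible P \<nu> \<mu> F"
    and "f \<in> F"
  shows "tendsto_L2 M (\<lambda>q. avg X (generation q) f) (\<lambda>_. \<integral>x. f x \<partial>\<mu>)
    \<and> tendsto_L2 M (\<lambda>r. avg X (tree_upto r) f) (\<lambda>_. \<integral>x. f x \<partial>\<mu>)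
    \<and> tendsto_L2 M (\<lambda>n. perm_avg X Perm n f) (\<lambda>_. \<integral>x. f x \<partial>\<mu>)"
proof -
  interpret bifurcating_markov_chain M Fil X \<nu> P by fact
  interpret admissible_bifurcating_markov_chain M Fil X \<nu> P \<mu> F
    by unfold_locales (use transition assms in auto)
  define c where "c = (\<integral>x. f x \<partial>\<mu>)"
  \<comment> \<open>Centring: constants belong to \<open>F\<close>, hence so does \<open>g\<close>,
    and the mean-zero results apply to it.\<close>
  define g where "g x = f x + (- c)" for x
  have g: "g \<in> F" unfolding g_def by (intro F_add F_const assms)
  have mean: "(\<integral>x. g x \<partial>\<mu>) = 0"
  proof -
    have "prob_space \<mu>" "integrable \<mu> f" using assms by (auto simp: admissible_def)
    then interpret \<mu>: prob_space \<mu> by simp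
    show ?thesis using \<open>integrable \<mu> f\<close> by (simp add: g_def c_def \<mu>.prob_space)
  qed
  have avg_g: "avg X I f \<omega> - c = avg X I g \<omega>" if "finite I" "I \<noteq> {}" for I \<omega>
    using that by (simp add: avg_def g_def sum_subtractf divide_simps)
  have perm_avg_g: "perm_avg X Perm n f \<omega> - c = perm_avg X Perm n g \<omega>" if "n \<ge> 1" for n \<omega>
    using that by (simp add: perm_avg_def g_def sum_subtractf divide_simps)
  have const: "square_integrable M (\<lambda>_. c)" by (simp add: square_integrable_def)
  have "tendsto_L2 M (\<lambda>q. avg X (generation q) f) (\<lambda>_. c)"
  proof -
    have "generation q \<noteq> {}" "0 \<notin> generation q" for q by (auto simp: generation_def)
    then show ?thesis
      using avg_generation_second_moment_tendsto_zero[OF g mean]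
      by (simp add: tendsto_L2_def const square_integrable_avg assms avg_g)
  qed
  moreover have "tendsto_L2 M (\<lambda>r. avg X (tree_upto r) f) (\<lambda>_. c)"
  proof -
    have "1 \<in> tree_upto r" for r
      unfolding tree_upto_def by (rule UN_I[of 0]) (simp_all add: generation_0)
    then have "tree_upto r \<noteq> {}" "0 \<notin> tree_upto r" "finite (tree_upto r)" for r
      by (auto simp: tree_upto_eq)
    then show ?thesis
      using avg_tree_second_moment_tendsto_zero[OF g mean]
      by (simp add: tendsto_L2_def const square_integrable_avg assms avg_g)
  qed
  moreover have "tendsto_L2 M (\<lambda>n. perm_avg X Perm n f) (\<lambda>_. c)"
  proof -
    \<comment> \<open>Only eventual equality is claimed: at \<open>n = 0\<close> both averages are
      0, so subtracting \<open>c\<close> need not turn one into the other.\<close>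
    have "\<forall>\<^sub>F n in sequentially. (\<integral>\<omega>. (perm_avg X Perm n g \<omega>)\<^sup>2 \<partial>M) = (\<integral>\<omega>. (perm_avg X Perm n f \<omega> - c)\<^sup>2 \<partial>M)"
      using eventually_ge_at_top[of 1] by eventually_elim (simp add: perm_avg_g)
    from Lim_transform_eventually[OF perm_avg_second_moment_tendsto_zero[OF assms(2,3) g mean] this]
    show ?thesis
      by (simp add: tendsto_L2_def const square_integrable_perm_avg assms)
  qed
  ultimately show ?thesis by (simp add: c_def)
qed

end
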